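(* Let $E$ be a pseudo effect algebra satisfying (RDP) with $\mathcal S(E)\neq\emptyset$, and let $s\in\mathcal S(E)$. Then there is a unique regular Borel probability measure $\mu_s$ on $\mathcal B(\mathcal S(E))$ that is maximal in the Choquet ordering and satisfies $\mu_s\sim\delta_s$, and $$s(a)=\int_{\mathcal S(E)}\hat a(x)\,d\mu_s(x)\quad\text{for all }a\in E,$$ where $\hat a(x)=x(a)$ for $x\in\mathcal S(E)$.
   Context: Pseudo effect algebra: partial algebra $(E;+,0,1)$ such that for all $a,b,c$: (i) $a+b$ and $(a+b)+c$ exist iff $b+c$ and $a+(b+c)$ exist, and then they are equal; (ii) there is exactly one $d$ and one $e$ with $a+d=e+a=1$; (iii) if $a+b$ exists there are $d,e$ with $a+b=d+a=b+e$; (iv) if $1+a$ or $a+1$ exists then $a=0$. (RDP): whenever $a_1+a_2=b_1+b_2$ there are $d_1,\dots,d_4$ with $d_1+d_2=a_1$, $d_3+d_4=a_2$, $d_1+d_3=b_1$, $d_2+d_4=b_2$. A state on $E$ is a map $s:E\to[0,\infty)$ additive on defined sums with $s(1)=1$; $\mathcal S(E)$ is the set of states, a compact convex set in the topology of pointwise convergence. $\mathcal B(K)$ is the Borel $\sigma$-algebra of $K$; $\delta_s$ is the Dirac measure at $s$. For a compact convex $K$, $\mathrm{Aff}(K)$ denotes continuous affine real functions and $\mathrm{Con}(K)$ continuous convex real functions on $K$. For nonnegative regular Borel measures: $\mu\sim\lambda$ iff $\int f\,d\mu=\int f\,d\lambda$ for all $f\in\mathrm{Aff}(K)$; the Choquet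 ordering is $\mu\prec\lambda$ iff $\int f\,d\mu\le\int f\,d\lambda$ for all $f\in\mathrm{Con}(K)$; maximal means maximal with respect to $\prec$. *)

theory Defs
  imports "HOL-Analysis.Analysis" "HOL-Probability.Probability"
begin

text \<open>A pseudo effect algebra on the whole type 'a: partial addition pe
  (None = undefined), constants zero and one.\<close>

definition pseudo_effect_algebra ::
  "('a \<Rightarrow> 'a \<Rightarrow> 'a option) \<Rightarrow> 'a \<Rightarrow> 'a \<Rightarrow> bool" where
  "pseudo_effect_algebra pe z u \<longleftrightarrow>
     (\<forall>a b c. (pe a b \<bind> (\<lambda>x. pe x c)) = (pe b c \<bind> (\<lambda>y. pe a y))) \<and>
     (\<forall>a. (\<exists>!d. pe a d = Some u) \<and> (\<exists>!e. pe e a = Some u)) \<and>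
     (\<forall>a b. pe a b \<noteq> None \<longrightarrow> (\<exists>d e. pe a b = pe d a \<and> pe a b = pe b e)) \<and>
     (\<forall>a. (pe u a \<noteq> None \<or> pe a u \<noteq> None) \<longrightarrow> a = z)"

definition RDP :: "('a \<Rightarrow> 'a \<Rightarrow> 'a option) \<Rightarrow> bool" where
  "RDP pe \<longleftrightarrow> (\<forall>a1 a2 b1 b2. pe a1 a2 \<noteq> None \<and> pe a1 a2 = pe b1 b2 \<longrightarrow>
     (\<exists>d1 d2 d3 d4. pe d1 d2 = Some a1 \<and> pe d3 d4 = Some a2 \<and>
                    pe d1 d3 = Some b1 \<and> pe d2 d4 = Some b2))"

definition is_state :: "('a \<Rightarrow> 'a \<Rightarrow> 'a option) \<Rightarrow> 'a \<Rightarrow> ('a \<Rightarrow> real) \<Rightarrow> bool" where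
  "is_state pe u s \<longleftrightarrow> (\<forall>a. 0 \<le> s a) \<and>
     (\<forall>a b c. pe a b = Some c \<longrightarrow> s c = s a + s b) \<and> s u = 1"

text \<open>The state space, as a subset of 'a => real with the product topology
  (topology of pointwise convergence).\<close>
definition states :: "('a \<Rightarrow> 'a \<Rightarrow> 'a option) \<Rightarrow> 'a \<Rightarrow> ('a \<Rightarrow> real) set" where
  "states pe u = {s. is_state pe u s}"

definition cmb :: "real \<Rightarrow> ('a \<Rightarrow> real) \<Rightarrow> ('a \<Rightarrow> real) \<Rightarrow> ('a \<Rightarrow> real)" where
  "cmb t x y = (\<lambda>i. t * x i + (1 - t) * y i)"

definition Aff :: "('a \<Rightarrow> real) set \<Rightarrow> (('a \<Rightarrow> real) \<Rightarrow> real) set" where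
  "Aff K = {f. continuous_on K f \<and>
     (\<forall>x\<in>K. \<forall>y\<in>K. \<forall>t\<in>{0..1}. f (cmb t x y) = t * f x + (1 - t) * f y)}"

definition Con :: "('a \<Rightarrow> real) set \<Rightarrow> (('a \<Rightarrow> real) \<Rightarrow> real) set" where
  "Con K = {f. continuous_on K f \<and>
     (\<forall>x\<in>K. \<forall>y\<in>K. \<forall>t\<in>{0..1}. f (cmb t x y) \<le> t * f x + (1 - t) * f y)}"

definition borelK :: "('b::topological_space) set \<Rightarrow> 'b measure" where
  "borelK K = restrict_space borel K"

definition regular_borel_measure :: "('b::topological_space) set \<Rightarrow> 'b measure \<Rightarrow> bool" where
  "regular_borel_measure K M \<longleftrightarrow>
     sets M = sets (borelK K) \<and> finite_measure M \<and>
     (\<forall>A\<in>sets M.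
        emeasure M A = (SUP C\<in>{C. compact C \<and> C \<subseteq> A}. emeasure M C) \<and>
        emeasure M A = (INF U\<in>{U. openin (top_of_set K) U \<and> A \<subseteq> U}. emeasure M U))"

definition aff_equiv :: "('a \<Rightarrow> real) set \<Rightarrow> ('a \<Rightarrow> real) measure \<Rightarrow> ('a \<Rightarrow> real) measure \<Rightarrow> bool" where
  "aff_equiv K M N \<longleftrightarrow> (\<forall>f\<in>Aff K. (\<integral>x. f x \<partial>M) = (\<integral>x. f x \<partial>N))"

definition choquet_le :: "('a \<Rightarrow> real) set \<Rightarrow> ('a \<Rightarrow> real) measure \<Rightarrow> ('a \<Rightarrow> real) measure \<Rightarrow> bool" where
  "choquet_le K M N \<longleftrightarrow> (\<forall>f\<in>Con K. (\<integral>x. f x \<partial>M) \<le> (\<integral>x. f x \<partial>N))"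

definition choquet_maximal :: "('a \<Rightarrow> real) set \<Rightarrow> ('a \<Rightarrow> real) measure \<Rightarrow> bool" where
  "choquet_maximal K M \<longleftrightarrow> regular_borel_measure K M \<and>
     (\<forall>N. regular_borel_measure K N \<and> choquet_le K M N \<longrightarrow> N = M)"

end

theory Submission
  imports Defs
begin

text \<open>
  Represent a finite decomposition \<open>s = m\<^sub>1 + \<dots> + m\<^sub>n\<close> into positive additive maps by the
  discrete measure with mass \<open>m\<^sub>i u\<close> at the state \<open>m\<^sub>i / m\<^sub>i u\<close>; its barycentre is \<open>s\<close>.
  By (RDP), two positive additive maps have an infimum, so any two decompositions have a common
  refinement, and refining increases the integral of a convex function. Hence the discrete
  measures representing \<open>s\<close> are directed, and the supremum \<open>L f\<close> of their integrals of
  \<open>f\<close> is additive in the convex function \<open>f\<close>. As differences of continuous convex functions are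
  dense in the continuous functions, \<open>L\<close> extends to a positive functional, which comes from a
  regular measure by the Riesz representation theorem. Cutting the state space into small pieces
  shows that every regular measure representing \<open>s\<close> is bounded by \<open>L\<close> on convex functions.
  So the measure of \<open>L\<close> is the greatest one representing \<open>s\<close> in the Choquet ordering.
\<close>

section \<open>The Riesz representation theorem on a compact Hausdorff set\<close>

text \<open>Aiming at a greatest measure rather than at a maximal one makes uniqueness easy: every
  maximal measure representing \<open>s\<close> lies below it and so equals it. The price is that
  one functional has to attain all upper envelopes at once, and the envelope of a sum is in general
  only at most the sum of the envelopes. Equality is exactly what common refinements give.
  Refinements are taken in the cone of unnormalised states. There a convex \<open>f\<close> becomes
  the subadditive function \<open>m u * f (m / m u)\<close>, so pieces of mass zero need no separate
  bookkeeping. The infimum of \<open>m\<close> and \<open>p\<close> at \<open>a\<close> is the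
  infimum of \<open>m b + p c\<close> over \<open>b + c = a\<close>. (RDP) makes it superadditive.
  Subadditivity requires joining \<open>a1 + a2\<close> and \<open>b1 + b2\<close> into one
  decomposition with \<open>a1\<close>, \<open>b1\<close> in front, which noncommutativity forbids;
  axiom (iii) repairs this because additive maps do not notice the element that gets exchanged. An
  affine function and its negative are both convex, so additivity forces \<open>L\<close> to take
  the value at \<open>s\<close> on affine functions, which is the barycentre condition.\<close>

lemma compact_Urysohn:
  fixes K :: "'b::topological_space set"
  assumes K: "compact K" "Hausdorff_space (top_of_set K)" and S: "closedin (top_of_set K) S" and T: "closedin (top_of_set K) T"
    and "S \<inter> T = {}"
  obtains f :: "'b \<Rightarrow> real" where "continuous_on K f" "\<And>x. x \<in> K \<Longrightarrow> 0 \<le> f x \<and> f x \<le> 1"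
    "\<And>x. x \<in> S \<Longrightarrow> f x = 0" "\<And>x. x \<in> T \<Longrightarrow> f x = 1"
proof -
  have "compact_space (top_of_set K)"
    using K by (simp add: compact_space_subtopology)
  then have "normal_space (top_of_set K)"
    using K by (intro compact_Hausdorff_or_regular_imp_normal_space disjI1)
  moreover have "disjnt S T" using assms by (simp add: disjnt_def)
  ultimately obtain f where f: "continuous_map (top_of_set K) (top_of_set {0..1::real}) f"
      "f ` S \<subseteq> {0}" "f ` T \<subseteq> {1}"
    by (rule Urysohn_lemma[OF _ S T _ zero_le_one])
  show thesis
  proof
    show "continuous_on K f"
      using f(1) by (auto simp: continuous_map_in_subtopology)
    show "x \<in> K \<Longrightarrow> 0 \<le> f x \<and> f x \<le> 1" for x
      using f(1) by (force simp: continuous_map_in_subtopology)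
  qed (use f in auto)
qed

lemma space_borelK: "space (borelK K) = K"
  by (simp add: borelK_def space_restrict_space)

lemma openin_borelK: "openin (top_of_set K) U \<Longrightarrow> U \<in> sets (borelK K)"
  unfolding borelK_def sets_restrict_space openin_open by (blast intro: borel_open)

lemma closedin_borelK: "closedin (top_of_set K) C \<Longrightarrow> C \<in> sets (borelK K)"
  unfolding borelK_def sets_restrict_space closedin_closed by (blast intro: borel_closed)

lemma borel_measurable_borelK: "continuous_on K f \<Longrightarrow> f \<in> borel_measurable (borelK K)"
  unfolding borelK_def by (rule borel_measurable_continuous_on_restrict)

lemma compact_abs_bound:
  fixes f :: "'b::topological_space \<Rightarrow> real"
  assumes "compact K" "continuous_on K f"
  obtains B where "0 < B" "\<And>x. x \<in> K \<Longrightarrow> \<bar>f x\<bar> \<le> B"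
proof -
  have "bounded (f ` K)"
    using assms by (intro compact_imp_bounded compact_continuous_image)
  then show thesis
    using that by (force simp: bounded_pos)
qed

lemma integrable_continuous_borelK:
  fixes f :: "'b::topological_space \<Rightarrow> real"
  assumes K: "compact K" and M: "finite_measure M" "sets M = sets (borelK K)"
    and f: "continuous_on K f"
  shows "integrable M f"
proof -
  obtain B where B: "\<And>x. x \<in> K \<Longrightarrow> \<bar>f x\<bar> \<le> B"
    using compact_abs_bound[OF K f] by metis
  have "space M = K"
    using sets_eq_imp_space_eq[OF M(2)] by (simp add: space_borelK)
  moreover have "f \<in> borel_measurable M"
    using borel_measurable_borelK[OF f] M(2) by (simp cong: measurable_cong_sets)
  ultimately show ?thesis
    using B by (intro finite_measure.integrable_const_bound[OF M(1), of f B]) auto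
qed

section \<open>Positive functionals: the content of open sets and its outer measure\<close>

locale positive_functional =
  fixes K :: "'b::topological_space set" and I :: "('b \<Rightarrow> real) \<Rightarrow> real"
  assumes compact_K: "compact K" and Hausdorff_K: "Hausdorff_space (top_of_set K)"
    and add: "\<And>f g. continuous_on K f \<Longrightarrow> continuous_on K g \<Longrightarrow> I (\<lambda>x. f x + g x) = I f + I g"
    and scale: "\<And>c f. 0 \<le> c \<Longrightarrow> continuous_on K f \<Longrightarrow> I (\<lambda>x. c * f x) = c * I f"
    and mono: "\<And>f g. continuous_on K f \<Longrightarrow> continuous_on K g \<Longrightarrow> (\<And>x. x \<in> K \<Longrightarrow> f x \<le> g x) \<Longrightarrow> I f \<le> I g"
begin

lemma zero: "I (\<lambda>x. 0) = 0"
  using scale[of 0 "\<lambda>x. 0"] by simp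

lemma nonneg: "continuous_on K f \<Longrightarrow> (\<And>x. x \<in> K \<Longrightarrow> 0 \<le> f x) \<Longrightarrow> 0 \<le> I f"
  using mono[of "\<lambda>x. 0" f] zero by simp

lemma sum:
  assumes "\<And>i. i \<in> J \<Longrightarrow> continuous_on K (f i)"
  shows "I (\<lambda>x. \<Sum>i\<in>J. f i x) = (\<Sum>i\<in>J. I (f i))"
  using assms
  by (induction J rule: infinite_finite_induct) (auto simp: zero add continuous_on_sum)

text \<open>Vanishing off \<open>U\<close> replaces compact support inside \<open>U\<close>.
  \<open>supported_truncate\<close> makes up for the difference: lowering \<open>f\<close> by
  \<open>e\<close> leaves a function that vanishes off the closed set where
  \<open>e \<le> f\<close>, and this set lies in \<open>U\<close>.\<close>

definition supported :: "'b set \<Rightarrow> ('b \<Rightarrow> real) \<Rightarrow> bool" where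
  "supported U f \<longleftrightarrow> continuous_on K f \<and> (\<forall>x\<in>K. 0 \<le> f x \<and> f x \<le> 1) \<and> (\<forall>x\<in>K - U. f x = 0)"

definition content :: "'b set \<Rightarrow> ennreal" where
  "content U = (SUP f\<in>{f. supported U f}. ennreal (I f))"

definition outer :: "'b set \<Rightarrow> ennreal" where
  "outer A = (INF U\<in>{U. openin (top_of_set K) U \<and> A \<subseteq> U}. content U)"

lemma supported_content: "supported U f \<Longrightarrow> ennreal (I f) \<le> content U"
  unfolding content_def by (rule SUP_upper) simp

lemma supported_mono: "supported U f \<Longrightarrow> U \<subseteq> V \<Longrightarrow> supported V f"
  by (auto simp: supported_def)

lemma supported_nonneg: "supported U f \<Longrightarrow> 0 \<le> I f"
  by (auto simp: supported_def intro: nonneg)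

lemma supported_zero: "supported U (\<lambda>x. 0)"
  by (auto simp: supported_def)

lemma content_mono: "U \<subseteq> V \<Longrightarrow> content U \<le> content V"
  unfolding content_def by (rule SUP_subset_mono) (auto intro: supported_mono)

lemma supported_truncate:
  assumes "supported U f" "0 \<le> e"
  shows "supported U (\<lambda>x. max 0 (f x - e))"
    and "I f \<le> I (\<lambda>x. max 0 (f x - e)) + e * I (\<lambda>x. 1)"
proof -
  have c: "continuous_on K f" using assms by (auto simp: supported_def)
  have ct: "continuous_on K (\<lambda>x. max 0 (f x - e))"
    by (intro continuous_intros c)
  show "supported U (\<lambda>x. max 0 (f x - e))"
    unfolding supported_def
  proof (intro conjI ballI ct)
    show "max 0 (f x - e) \<le> 1" if "x \<in> K" for x
      using assms that unfolding supported_def by (smt (verit))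
    show "max 0 (f x - e) = 0" if "x \<in> K - U" for x
      using assms that unfolding supported_def by simp
  qed auto
  have "I f \<le> I (\<lambda>x. max 0 (f x - e) + e * 1)"
    by (rule mono) (auto intro: continuous_on_add ct c)
  also have "\<dots> = I (\<lambda>x. max 0 (f x - e)) + I (\<lambda>x. e * 1)"
    by (rule add) (auto intro: ct)
  also have "I (\<lambda>x. e * 1) = e * I (\<lambda>x. 1)"
    by (rule scale) (auto simp: assms)
  finally show "I f \<le> I (\<lambda>x. max 0 (f x - e)) + e * I (\<lambda>x. 1)" .
qed

lemma closedin_superlevel: "continuous_on K f \<Longrightarrow> closedin (top_of_set K) {x \<in> K. e \<le> f x}"
  for f :: "'b \<Rightarrow> real"
  using continuous_closedin_preimage[of K f "{e..}"] by (simp add: vimage_def Int_def)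

lemma openin_superlevel: "continuous_on K f \<Longrightarrow> openin (top_of_set K) {x \<in> K. e < f x}"
  for f :: "'b \<Rightarrow> real"
  using continuous_openin_preimage_gen[of K f "{e<..}"] by (simp add: vimage_def Int_def)

text \<open>Bounding the truncated functions is enough, because truncation at height
  \<open>e\<close> loses at most \<open>e * I (\<lambda>x. 1)\<close>, which is arbitrarily
  small.\<close>

lemma content_leI:
  assumes "\<And>f e. supported U f \<Longrightarrow> 0 < e \<Longrightarrow> ennreal (I (\<lambda>x. max 0 (f x - e))) \<le> c"
  shows "content U \<le> c"
  unfolding content_def
proof (rule SUP_least, clarify)
  fix f assume f: "supported U f"
  show "ennreal (I f) \<le> c"
  proof (rule ennreal_le_epsilon)
    fix d :: real assume "0 < d"
    have one: "0 \<le> I (\<lambda>x. 1)" by (rule nonneg) auto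
    \<comment> \<open>The summand 1 keeps the denominator positive even if \<open>I\<close> vanishes
      on constants.\<close>
    define e where "e = d / (1 + I (\<lambda>x. 1))"
    have e: "0 < e" using \<open>0 < d\<close> one by (simp add: e_def)
    have "e * I (\<lambda>x. 1) \<le> d"
      using one \<open>0 < d\<close> by (simp add: e_def field_simps)
    then have "I f \<le> I (\<lambda>x. max 0 (f x - e)) + d"
      using supported_truncate(2)[OF f, of e] e by linarith
    then have "ennreal (I f) \<le> ennreal (I (\<lambda>x. max 0 (f x - e)) + d)"
      by (rule ennreal_leI)
    also have "\<dots> = ennreal (I (\<lambda>x. max 0 (f x - e))) + ennreal d"
      using supported_nonneg[OF supported_truncate(1)[OF f]] e \<open>0 < d\<close> by (intro ennreal_plus) auto
    also have "\<dots> \<le> c + ennreal d"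
      using assms[OF f e] by (simp add: add_right_mono)
    finally show "ennreal (I f) \<le> c + ennreal d" .
  qed
qed

text \<open>A two-piece partition of unity on the closed set \<open>C\<close> that carries the
  truncated function: \<open>g\<close> is 0 on \<open>C - U\<close> and 1 on \<open>C - V\<close>,
  so \<open>f' * g\<close> vanishes off \<open>U\<close> and \<open>f' * (1 - g)\<close> vanishes
  off \<open>V\<close>.\<close>

lemma content_Un:
  assumes U: "openin (top_of_set K) U" and V: "openin (top_of_set K) V"
  shows "content (U \<union> V) \<le> content U + content V"
proof (rule content_leI)
  fix f and e :: real assume f: "supported (U \<union> V) f" and e: "0 < e"
  define f' where "f' = (\<lambda>x. max 0 (f x - e))"
  define C where "C = {x \<in> K. e \<le> f x}"
  have f': "supported (U \<union> V) f'"
    unfolding f'_def using supported_truncate(1)[OF f] e by simp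
  have C: "closedin (top_of_set K) C"
    unfolding C_def using f by (intro closedin_superlevel) (simp add: supported_def)
  have CUV: "C \<subseteq> U \<union> V"
    using f e by (force simp: C_def supported_def)
  have "closedin (top_of_set K) (C - U)" "closedin (top_of_set K) (C - V)"
    using C U V by (auto intro: closedin_diff)
  moreover have "(C - U) \<inter> (C - V) = {}" using CUV by auto
  ultimately obtain g :: "'b \<Rightarrow> real" where g: "continuous_on K g" "\<And>x. x \<in> K \<Longrightarrow> 0 \<le> g x \<and> g x \<le> 1"
    "\<And>x. x \<in> C - U \<Longrightarrow> g x = 0" "\<And>x. x \<in> C - V \<Longrightarrow> g x = 1"
    by (rule compact_Urysohn[OF compact_K Hausdorff_K]) blast
  have z: "f' x = 0" if "x \<in> K" "x \<notin> C" for x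
    using that by (auto simp: C_def f'_def)
  have c: "continuous_on K f'" "\<And>x. x \<in> K \<Longrightarrow> 0 \<le> f' x \<and> f' x \<le> 1"
    using f' by (auto simp: supported_def)
  have 1: "supported U (\<lambda>x. f' x * g x)"
    unfolding supported_def
  proof (intro conjI ballI)
    show "continuous_on K (\<lambda>x. f' x * g x)" by (intro continuous_intros c g)
    show "f' x * g x = 0" if "x \<in> K - U" for x
      using that z[of x] g(3)[of x] by (cases "x \<in> C") auto
  qed (use c g in \<open>auto intro: mult_le_one\<close>)
  have 2: "supported V (\<lambda>x. f' x * (1 - g x))"
    unfolding supported_def
  proof (intro conjI ballI)
    show "continuous_on K (\<lambda>x. f' x * (1 - g x))" by (intro continuous_intros c g)
    show "f' x * (1 - g x) = 0" if "x \<in> K - V" for x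
      using that z[of x] g(4)[of x] by (cases "x \<in> C") auto
  qed (use c g in \<open>auto intro: mult_le_one\<close>)
  have "I f' = I (\<lambda>x. f' x * g x + f' x * (1 - g x))"
    by (simp add: algebra_simps)
  also have "\<dots> = I (\<lambda>x. f' x * g x) + I (\<lambda>x. f' x * (1 - g x))"
    using 1 2 by (intro add) (auto simp: supported_def)
  finally have "ennreal (I f') = ennreal (I (\<lambda>x. f' x * g x)) + ennreal (I (\<lambda>x. f' x * (1 - g x)))"
    using 1 2 by (simp add: supported_nonneg)
  also have "\<dots> \<le> content U + content V"
    using 1 2 by (intro add_mono supported_content)
  finally show "ennreal (I f') \<le> content U + content V" .
qed

lemma content_empty: "content {} = 0"
proof -
  have "I f \<le> 0" if "supported {} f" for f
    using that mono[of f "\<lambda>x. 0"] zero by (auto simp: supported_def)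
  then show ?thesis
    unfolding content_def by (auto simp: SUP_eq_iff ennreal_neg intro!: antisym SUP_least)
qed

text \<open>The closed set \<open>C\<close> off which the truncated function vanishes is compact, so
  finitely many of the open sets cover it and finite subadditivity applies.\<close>

lemma content_UN:
  fixes U :: "nat \<Rightarrow> 'b set"
  assumes U: "\<And>i. openin (top_of_set K) (U i)"
  shows "content (\<Union>i. U i) \<le> (\<Sum>i. content (U i))"
proof (rule content_leI)
  fix f and e :: real assume f: "supported (\<Union>i. U i) f" and e: "0 < e"
  define C where "C = {x \<in> K. e \<le> f x}"
  have C: "closedin (top_of_set K) C"
    unfolding C_def using f by (intro closedin_superlevel) (simp add: supported_def)
  then have "compact C"
    using compact_K closedin_compact by blast
  have "\<forall>i. \<exists>T. open T \<and> U i = K \<inter> T" using U by (simp add: openin_open)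
  from choice[OF this] obtain T where "\<forall>i. open (T i) \<and> U i = K \<inter> T i" ..
  then have T: "\<And>i. open (T i)" "\<And>i. U i = K \<inter> T i" by auto
  have CT: "C \<subseteq> (\<Union>i. T i)"
  proof
    fix x assume "x \<in> C"
    then have "x \<in> K" "f x \<noteq> 0" using e by (auto simp: C_def)
    then have "x \<in> (\<Union>i. U i)" using f by (auto simp: supported_def)
    then show "x \<in> (\<Union>i. T i)" unfolding T(2) by auto
  qed
  obtain J where J: "finite J" "C \<subseteq> (\<Union>i\<in>J. T i)"
    by (rule compactE_image[OF \<open>compact C\<close> T(1) CT]) blast
  then obtain n where n: "J \<subseteq> {..<n}"
    using finite_nat_iff_bounded by blast
  have "supported (\<Union>i<n. U i) (\<lambda>x. max 0 (f x - e))"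
    using supported_truncate(1)[OF f, of e] e J n T(2)
    unfolding supported_def C_def by (fastforce simp: subset_iff)
  then have "ennreal (I (\<lambda>x. max 0 (f x - e))) \<le> content (\<Union>i<n. U i)"
    by (rule supported_content)
  also have "\<dots> \<le> (\<Sum>i<n. content (U i))"
  proof (induction n)
    case (Suc n)
    have "content (\<Union>i<Suc n. U i) = content ((\<Union>i<n. U i) \<union> U n)"
      by (simp add: lessThan_Suc Un_commute)
    also have "\<dots> \<le> content (\<Union>i<n. U i) + content (U n)"
      using U by (intro content_Un) auto
    finally show ?case using Suc by (simp add: add_mono order_trans)
  qed (simp add: content_empty)
  also have "\<dots> \<le> (\<Sum>i. content (U i))"
    by (rule sum_le_suminf) auto
  finally show "ennreal (I (\<lambda>x. max 0 (f x - e))) \<le> (\<Sum>i. content (U i))" .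
qed

lemma outer_open: "openin (top_of_set K) U \<Longrightarrow> outer U = content U"
  unfolding outer_def by (intro antisym INF_lower INF_greatest) (auto intro: content_mono)

lemma outer_mono: "A \<subseteq> B \<Longrightarrow> outer A \<le> outer B"
  unfolding outer_def by (rule INF_superset_mono) auto

lemma outer_approx:
  assumes "outer A < \<infinity>" "0 < e"
  obtains U where "openin (top_of_set K) U" "A \<subseteq> U" "content U \<le> outer A + e"
proof -
  have "outer A < outer A + e"
    using assms by (metis ennreal_add_left_cancel_less infinity_ennreal_def add.right_neutral order_less_irrefl)
  then obtain U where "openin (top_of_set K) U" "A \<subseteq> U" "content U < outer A + e"
    by (subst (asm) outer_def) (auto simp: INF_less_iff)
  then show thesis using that by (meson less_imp_le)
qed

lemma content_finite: "content U \<le> ennreal (I (\<lambda>x. 1))"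
  unfolding content_def
  by (rule SUP_least) (auto simp: supported_def intro!: ennreal_leI mono)

lemma outer_finite: "A \<subseteq> K \<Longrightarrow> outer A \<le> ennreal (I (\<lambda>x. 1))"
  using outer_mono[of A K] outer_open[of K] content_finite[of K] by simp

lemma outer_UN:
  fixes A :: "nat \<Rightarrow> 'b set"
  assumes A: "\<And>i. A i \<subseteq> K"
  shows "outer (\<Union>i. A i) \<le> (\<Sum>i. outer (A i))"
proof (rule ennreal_le_epsilon)
  fix e :: real assume e: "0 < e"
  have "\<exists>U. openin (top_of_set K) U \<and> A i \<subseteq> U \<and> content U \<le> outer (A i) + ennreal (e * (1/2)^Suc i)" for i
    using outer_approx[of "A i" "ennreal (e * (1/2)^Suc i)"] outer_finite[OF A, of i] e
    by (metis ennreal_less_top ennreal_less_zero_iff infinity_ennreal_def order_le_less_trans mult_pos_pos zero_less_power half_gt_zero zero_less_one)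
  then obtain U where U: "\<And>i. openin (top_of_set K) (U i)" "\<And>i. A i \<subseteq> U i"
      "\<And>i. content (U i) \<le> outer (A i) + ennreal (e * (1/2)^Suc i)"
    by metis
  have "outer (\<Union>i. A i) \<le> outer (\<Union>i. U i)"
    using U(2) by (intro outer_mono) auto
  also have "\<dots> = content (\<Union>i. U i)"
    using U(1) by (intro outer_open openin_clauses(3)) auto
  also have "\<dots> \<le> (\<Sum>i. content (U i))"
    using U(1) by (rule content_UN)
  also have "\<dots> \<le> (\<Sum>i. outer (A i) + ennreal (e * (1/2)^Suc i))"
    by (rule suminf_le) (use U(3) in auto)
  also have "\<dots> = (\<Sum>i. outer (A i)) + (\<Sum>i. ennreal (e * (1/2)^Suc i))"
    by (rule suminf_add[symmetric]) auto
  also have "(\<Sum>i. ennreal (e * (1/2)^Suc i)) = ennreal e"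
    using sums_mult[OF power_half_series, of e] e
    by (subst suminf_ennreal2) (auto simp: sums_iff)
  finally show "outer (\<Union>i. A i) \<le> (\<Sum>i. outer (A i)) + ennreal e" .
qed

lemma outer_empty: "outer {} = 0"
  using outer_open[of "{}"] content_empty by simp

section \<open>Caratheodory measurability of the Borel sets\<close>

lemma outer_measure_space: "outer_measure_space (Pow K) outer"
  unfolding outer_measure_space_def positive_def increasing_def countably_subadditive_def
  using outer_empty outer_mono outer_UN by (auto simp: image_subset_iff)

text \<open>For an open \<open>V\<close> containing \<open>A\<close>, take a function that nearly
  exhausts the content of \<open>V \<inter> U\<close>. Its truncation \<open>f'\<close> vanishes off
  a closed \<open>C\<close> inside \<open>V \<inter> U\<close>. Any \<open>g\<close> supported in
  \<open>V - C\<close>, an open set containing \<open>A - U\<close>, can be added to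
  \<open>f'\<close> without exceeding 1, so the two contents together stay below that of
  \<open>V\<close>.\<close>

lemma outer_split:
  assumes A: "A \<subseteq> K" and U: "openin (top_of_set K) U"
  shows "outer (A \<inter> U) + outer (A - U) \<le> outer A"
  unfolding outer_def[of A]
proof (rule INF_greatest, clarify)
  fix V assume V: "openin (top_of_set K) V" "A \<subseteq> V"
  have UV: "openin (top_of_set K) (V \<inter> U)" using U V by auto
  have fin: "outer (A - U) < top" using outer_finite[of "A - U"] A
    by (metis Diff_subset dual_order.trans ennreal_less_top order_le_less_trans)
  have main: "ennreal (I (\<lambda>x. max 0 (f x - e))) + outer (A - U) \<le> content V"
    if f: "supported (V \<inter> U) f" and e: "0 < e" for f e
  proof -
    define f' where "f' = (\<lambda>x. max 0 (f x - e))"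
    have f': "supported (V \<inter> U) f'"
      unfolding f'_def using supported_truncate(1)[OF f] e by simp
    define C where "C = {x \<in> K. e \<le> f x}"
    have C: "closedin (top_of_set K) C"
      unfolding C_def using f by (intro closedin_superlevel) (simp add: supported_def)
    have CU: "C \<subseteq> V \<inter> U"
      using f e by (force simp: C_def supported_def)
    have W: "openin (top_of_set K) (V - C)" using V C by (auto intro: openin_diff)
    have "content (V - C) + ennreal (I f')
        = (SUP g\<in>{g. supported (V - C) g}. ennreal (I g) + ennreal (I f'))"
      unfolding content_def using supported_zero
      by (intro ennreal_SUP_add_left[symmetric]) auto
    also have "\<dots> \<le> content V"
    proof (rule SUP_least, clarify)
      fix g assume g: "supported (V - C) g"
      have "supported V (\<lambda>x. f' x + g x)"
        unfolding supported_def
      proof (intro conjI ballI)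
        show "continuous_on K (\<lambda>x. f' x + g x)"
          using f' g by (auto simp: supported_def intro: continuous_on_add)
        fix x assume x: "x \<in> K"
        show "0 \<le> f' x + g x" using x f' g by (auto simp: supported_def)
        show "f' x + g x \<le> 1"
        proof (cases "x \<in> C")
          case True
          then show ?thesis using x f' g by (auto simp: supported_def)
        next
          case False
          then have "f' x = 0" using x by (auto simp: C_def f'_def)
          then show ?thesis using x g by (auto simp: supported_def)
        qed
      next
        fix x assume "x \<in> K - V"
        then show "f' x + g x = 0" using f' g by (auto simp: supported_def)
      qed
      then have "ennreal (I (\<lambda>x. f' x + g x)) \<le> content V"
        by (rule supported_content)
      moreover have "I (\<lambda>x. f' x + g x) = I f' + I g"
        using f' g by (intro add) (auto simp: supported_def)
      ultimately show "ennreal (I g) + ennreal (I f') \<le> content V"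
        using supported_nonneg[OF f'] supported_nonneg[OF g] by (simp add: add.commute)
    qed
    finally have "content (V - C) + ennreal (I f') \<le> content V" .
    have "outer (A - U) \<le> content (V - C)"
      using V CU W unfolding outer_def by (intro INF_lower) auto
    then have "outer (A - U) + ennreal (I f') \<le> content (V - C) + ennreal (I f')"
      by (rule add_right_mono)
    also have "\<dots> \<le> content V" by fact
    finally show ?thesis
      unfolding f'_def by (simp add: add.commute)
  qed
  have "content (V \<inter> U) \<le> content V - outer (A - U)"
  proof (rule content_leI)
    fix f and e :: real assume "supported (V \<inter> U) f" "0 < e"
    then show "ennreal (I (\<lambda>x. max 0 (f x - e))) \<le> content V - outer (A - U)"
      using main[of f e] fin by (simp add: ennreal_le_minus_iff)
  qed
  moreover have "outer (A \<inter> U) \<le> content (V \<inter> U)"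
    using UV V unfolding outer_def by (intro INF_lower) auto
  \<comment> \<open>The zero function in \<open>main\<close> gives the inequality that makes the
    truncated subtraction of \<open>ennreal\<close> cancel.\<close>
  moreover have "outer (A - U) \<le> content V"
    using main[OF supported_zero zero_less_one] zero by simp
  ultimately have "outer (A \<inter> U) + outer (A - U) \<le> (content V - outer (A - U)) + outer (A - U)"
    by (intro add_right_mono) (rule order_trans)
  also have "\<dots> = content V"
    using \<open>outer (A - U) \<le> content V\<close> fin by (simp add: diff_add_cancel_ennreal)
  finally show "outer (A \<inter> U) + outer (A - U) \<le> content V" .
qed

lemma caratheodory_outer: "measure_space K (lambda_system K (Pow K) outer) outer"
  using sigma_algebra.caratheodory_lemma[OF sigma_algebra_Pow outer_measure_space] .

lemma open_in_lambda_system: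
  assumes U: "openin (top_of_set K) U"
  shows "U \<in> lambda_system K (Pow K) outer"
proof -
  have UK: "U \<subseteq> K" using openin_imp_subset[OF U] .
  interpret algebra K "Pow K" by (rule algebra_Pow)
  have sub: "subadditive (Pow K) outer"
    using outer_measure_space unfolding outer_measure_space_def
    by (intro countably_subadditive_subadditive) auto
  have "outer (U \<inter> A) + outer ((K - U) \<inter> A) = outer A" if A: "A \<subseteq> K" for A
  proof (rule antisym)
    have eq: "U \<inter> A = A \<inter> U" "(K - U) \<inter> A = A - U" "(A \<inter> U) \<union> (A - U) = A" using A by auto
    show "outer (U \<inter> A) + outer ((K - U) \<inter> A) \<le> outer A"
      unfolding eq using outer_split[OF A U] .
    have "outer ((A \<inter> U) \<union> (A - U)) \<le> outer (A \<inter> U) + outer (A - U)"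
      using A by (intro subadditiveD[OF sub]) auto
    then show "outer A \<le> outer (U \<inter> A) + outer ((K - U) \<inter> A)"
      unfolding eq .
  qed
  then show ?thesis
    using UK by (auto simp: lambda_system_def)
qed

lemma borelK_in_lambda_system: "sets (borelK K) \<subseteq> lambda_system K (Pow K) outer"
proof -
  let ?L = "lambda_system K (Pow K) outer"
  interpret L: sigma_algebra K ?L
    using caratheodory_outer by (simp add: measure_space_def)
  have L: "sets (sigma K ?L) = ?L" "space (sigma K ?L) = K"
    by (simp_all add: L.sets_measure_of_eq L.space_closed)
  \<comment> \<open>Measurability of the identity says that the traces on \<open>K\<close> of all
    Borel sets belong to \<open>?L\<close>, and it has to be tested on open sets only.\<close>
  have "(\<lambda>x. x) \<in> borel_measurable (sigma K ?L)"
  proof (rule borel_measurableI)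
    fix S :: "'b set" assume "open S"
    then show "(\<lambda>x. x) -` S \<inter> space (sigma K ?L) \<in> sets (sigma K ?L)"
      unfolding L using open_in_lambda_system[of "K \<inter> S"] by (auto simp: Int_commute)
  qed
  from measurable_sets[OF this] show ?thesis
    unfolding L borelK_def sets_restrict_space by (auto simp: Int_commute)
qed

section \<open>The representing measure and its regularity\<close>

definition representing :: "'b measure" where
  "representing = measure_of K (sets (borelK K)) outer"

lemma sigma_algebra_borelK: "sigma_algebra K (sets (borelK K))"
  using sets.sigma_algebra_axioms[of "borelK K"] by (simp add: space_borelK)

lemma sets_representing: "sets representing = sets (borelK K)"
  unfolding representing_def by (rule sigma_algebra.sets_measure_of_eq[OF sigma_algebra_borelK])

lemma space_representing: "space representing = K"
  using sets_eq_imp_space_eq[OF sets_representing] by (simp add: space_borelK)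

lemma emeasure_representing:
  assumes "A \<in> sets (borelK K)" shows "emeasure representing A = outer A"
  unfolding representing_def
proof (rule emeasure_measure_of_sigma[OF sigma_algebra_borelK _ _ assms])
  have "measure_space K (sets (borelK K)) outer"
    using measure_down[OF caratheodory_outer sigma_algebra_borelK borelK_in_lambda_system] .
  then show "positive (sets (borelK K)) outer" "countably_additive (sets (borelK K)) outer"
    by (auto simp: measure_space_def)
qed

lemma finite_representing: "finite_measure representing"
proof (rule finite_measureI)
  have "outer K < \<infinity>"
    using outer_finite[of K] by (auto intro: le_less_trans)
  then show "emeasure representing (space representing) \<noteq> \<infinity>"
    using emeasure_representing[of K] openin_borelK[of K K] by (auto simp: space_representing)
qed

sublocale representing: finite_measure representing
  by (rule finite_representing)

text \<open>Outer regularity is built into \<open>outer\<close>. Inner regularity follows by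
  complements: if an open \<open>U\<close> containing \<open>K - A\<close> exceeds it by at most
  \<open>e\<close>, then \<open>K - U\<close> is a compact subset of \<open>A\<close> that misses at
  most \<open>e\<close> of it.\<close>

lemma regular_representing: "regular_borel_measure K representing"
  unfolding regular_borel_measure_def
proof (intro conjI ballI sets_representing finite_representing)
  fix A assume A: "A \<in> sets representing"
  then have AK: "A \<subseteq> K" using sets.sets_into_space space_representing by blast
  have em: "emeasure representing U = content U" if "openin (top_of_set K) U" for U
    using emeasure_representing[OF openin_borelK[OF that]] outer_open[OF that] by simp
  show "emeasure representing A
      = (INF U\<in>{U. openin (top_of_set K) U \<and> A \<subseteq> U}. emeasure representing U)"
    using A emeasure_representing[of A] em unfolding sets_representing outer_def
    by (auto intro: INF_cong)
  show "emeasure representing A = (SUP C\<in>{C. compact C \<and> C \<subseteq> A}. emeasure representing C)"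
  proof (rule antisym)
    show "emeasure representing A \<le> (SUP C\<in>{C. compact C \<and> C \<subseteq> A}. emeasure representing C)"
    proof (rule ennreal_le_epsilon)
      fix e :: real assume e: "0 < e"
      have KA: "K - A \<in> sets representing"
        using A sets.compl_sets space_representing by metis
      have "outer (K - A) < \<infinity>"
        using outer_finite[of "K - A"] by (auto intro: le_less_trans)
      then obtain U where U: "openin (top_of_set K) U" "K - A \<subseteq> U"
          "content U \<le> outer (K - A) + ennreal e"
        using outer_approx[of "K - A" "ennreal e"] e by auto
      have Us: "U \<in> sets representing" "U \<subseteq> K"
        using openin_borelK[OF U(1)] openin_imp_subset[OF U(1)] by (auto simp: sets_representing)
      have "emeasure representing U \<le> emeasure representing (K - A) + ennreal e"
        using U KA by (simp add: em emeasure_representing sets_representing)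
      then have "ennreal (measure representing U) \<le> ennreal (measure representing (K - A) + e)"
        using e by (simp add: representing.emeasure_eq_measure)
      then have "measure representing U \<le> measure representing (K - A) + e"
        using e by (subst (asm) ennreal_le_iff) auto
      moreover have "measure representing (K - U) = measure representing K - measure representing U"
        "measure representing (K - A) = measure representing K - measure representing A"
        using representing.finite_measure_compl[OF Us(1)] representing.finite_measure_compl[OF A]
        by (simp_all add: space_representing)
      ultimately have "measure representing A \<le> measure representing (K - U) + e"
        by simp
      then have *: "emeasure representing A \<le> emeasure representing (K - U) + ennreal e"
        using e by (simp add: representing.emeasure_eq_measure flip: ennreal_plus)
      have "compact (K - U)"
        by (rule closedin_compact[OF compact_K closedin_diff[OF _ U(1)]]) simp
      moreover have "K - U \<subseteq> A" using U(2) by auto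
      ultimately have "emeasure representing (K - U)
          \<le> (SUP C\<in>{C. compact C \<and> C \<subseteq> A}. emeasure representing C)"
        by (intro SUP_upper) simp
      then have "emeasure representing (K - U) + ennreal e
          \<le> (SUP C\<in>{C. compact C \<and> C \<subseteq> A}. emeasure representing C) + ennreal e"
        by (rule add_right_mono)
      with * show "emeasure representing A
          \<le> (SUP C\<in>{C. compact C \<and> C \<subseteq> A}. emeasure representing C) + ennreal e"
        by (rule order_trans)
    qed
    show "(SUP C\<in>{C. compact C \<and> C \<subseteq> A}. emeasure representing C) \<le> emeasure representing A"
      using A by (auto intro!: SUP_least emeasure_mono)
  qed
qed

section \<open>Integrals against the representing measure\<close>

lemma integrable_representing: "continuous_on K f \<Longrightarrow> integrable representing f"
  for f :: "'b \<Rightarrow> real"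
  by (rule integrable_continuous_borelK[OF compact_K finite_representing sets_representing])

lemma measure_representing_open:
  assumes "openin (top_of_set K) U" "supported U f"
  shows "I f \<le> measure representing U"
proof -
  have "ennreal (I f) \<le> emeasure representing U"
    using supported_content[OF assms(2)] emeasure_representing[OF openin_borelK[OF assms(1)]]
      outer_open[OF assms(1)] by simp
  then show ?thesis
    by (simp add: representing.emeasure_eq_measure)
qed

lemma measure_representing_space: "measure representing K = I (\<lambda>x. 1)"
proof (rule antisym)
  show "I (\<lambda>x. 1) \<le> measure representing K"
    by (rule measure_representing_open) (auto simp: supported_def)
  have "emeasure representing K \<le> ennreal (I (\<lambda>x. 1))"
    using content_finite[of K] emeasure_representing[OF openin_borelK, of K] outer_open[of K] by auto
  then show "measure representing K \<le> I (\<lambda>x. 1)"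
    using nonneg[of "\<lambda>x. 1"] by (simp add: representing.emeasure_eq_measure)
qed

text \<open>A function with values in \<open>[0, 1]\<close> is cut into horizontal slices of height \<open>1 / n\<close>;
  the \<open>k\<close>-th slice is supported in the superlevel set at \<open>k / n\<close>.\<close>

lemma le_integral_representing_plus:
  assumes f: "supported K f" and n: "0 < (n::nat)"
  shows "I f \<le> (\<integral>x. f x \<partial>representing) + measure representing K / n"
proof -
  have c: "continuous_on K f" and f01: "\<And>x. x \<in> K \<Longrightarrow> 0 \<le> f x \<and> f x \<le> 1"
    using f by (auto simp: supported_def)
  define U where "U k = {x \<in> K. real k / n < f x}" for k :: nat
  have U: "openin (top_of_set K) (U k)" for k
    unfolding U_def using c by (rule openin_superlevel)
  then have Us: "U k \<in> sets representing" for k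
    by (simp add: sets_representing openin_borelK)
  define h where "h k x = min (f x) (real (Suc k) / n) - min (f x) (real k / n)" for k :: nat and x
  have hc: "continuous_on K (h k)" for k
    unfolding h_def[abs_def] by (intro continuous_intros c)
  have hI: "I (h k) \<le> measure representing (U k) / n" for k
  proof -
    have "supported (U k) (\<lambda>x. real n * h k x)"
      unfolding supported_def
    proof (intro conjI ballI)
      show "continuous_on K (\<lambda>x. real n * h k x)" by (intro continuous_intros hc)
      have le: "real k / n \<le> real (Suc k) / n" by (rule divide_right_mono) auto
      then have "0 \<le> h k x" for x
        unfolding h_def min_def by auto
      then show "0 \<le> real n * h k x" for x
        by simp
      have "h k x \<le> 1 / n" for x
        using n by (simp add: h_def min_def field_simps)
      then show "real n * h k x \<le> 1" for x
        using n by (simp add: field_simps)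
      show "real n * h k x = 0" if "x \<in> K - U k" for x
      proof -
        have "f x \<le> real k / n" using that by (auto simp: U_def)
        with le show ?thesis unfolding h_def min_def by auto
      qed
    qed
    then have "I (\<lambda>x. real n * h k x) \<le> measure representing (U k)"
      by (rule measure_representing_open[OF U])
    then show ?thesis
      using scale[OF _ hc, of "real n" k] n by (simp add: field_simps)
  qed
  have "I f \<le> I (\<lambda>x. \<Sum>k<n. h k x)"
  proof (rule mono[OF c])
    show "continuous_on K (\<lambda>x. \<Sum>k<n. h k x)" by (intro continuous_on_sum hc)
    have "(\<Sum>k<n. h k x) = min (f x) (real n / n) - min (f x) (real 0 / n)" for x
      unfolding h_def by (rule sum_lessThan_telescope)
    then show "f x \<le> (\<Sum>k<n. h k x)" if "x \<in> K" for x
      using f01[OF that] n by simp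
  qed
  also have "\<dots> = (\<Sum>k<n. I (h k))"
    by (rule sum) (rule hc)
  also have "\<dots> \<le> (\<Sum>k<n. measure representing (U k) / n)"
    by (intro sum_mono hI)
  also have "\<dots> = (\<integral>x. (\<Sum>k<n. indicator (U k) x / real n) \<partial>representing)"
    using Us by (subst Bochner_Integration.integral_sum) (auto simp: representing.emeasure_eq_measure)
  also have "\<dots> \<le> (\<integral>x. f x + 1 / real n \<partial>representing)"
  proof (rule integral_mono)
    show "integrable representing (\<lambda>x. \<Sum>k<n. indicator (U k) x / real n)"
      using Us by (auto simp: representing.emeasure_eq_measure)
    show "integrable representing (\<lambda>x. f x + 1 / real n)"
      by (intro integrable_representing continuous_intros c)
    fix x assume "x \<in> space representing"
    then have x: "x \<in> K" by (simp add: space_representing)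
    \<comment> \<open>Where \<open>f\<close> exceeds \<open>k / n\<close>, the slice between
      \<open>(k - 1) / n\<close> and \<open>k / n\<close> is full. Comparing with this lower slice
      shifts the telescoping sum down by one, and the bottom slice below 0 is the extra
      \<open>1 / n\<close>.\<close>
    have "(\<Sum>k<n. indicator (U k) x / real n)
        \<le> (\<Sum>k<n. min (f x) ((real (Suc k) - 1) / n) - min (f x) ((real k - 1) / n))"
      using f01[OF x] n
      by (intro sum_mono) (auto simp: U_def indicator_def min_def field_simps)
    also have "\<dots> = min (f x) ((real n - 1) / n) - min (f x) ((real 0 - 1) / n)"
      by (rule sum_lessThan_telescope)
    also have "\<dots> \<le> f x + 1 / n"
    proof -
      have "(real 0 - 1) / n = - (1 / n)" "0 \<le> 1 / real n" by simp_all
      with f01[OF x] show ?thesis by linarith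
    qed
    finally show "(\<Sum>k<n. indicator (U k) x / real n) \<le> f x + 1 / real n" .
  qed
  also have "\<dots> = (\<integral>x. f x \<partial>representing) + measure representing K / n"
    using integrable_representing[OF c] by (simp add: space_representing)
  finally show ?thesis .
qed

lemma le_integral_representing:
  assumes f: "supported K f"
  shows "I f \<le> (\<integral>x. f x \<partial>representing)"
proof (rule LIMSEQ_le_const)
  show "(\<lambda>n. (\<integral>x. f x \<partial>representing) + measure representing K / real n)
      \<longlonglongrightarrow> (\<integral>x. f x \<partial>representing)"
    using tendsto_add[OF tendsto_const lim_const_over_n] by force
  show "\<exists>N. \<forall>n\<ge>N. I f \<le> (\<integral>x. f x \<partial>representing) + measure representing K / real n"
    using le_integral_representing_plus[OF f] by (intro exI[of _ 1]) auto
qed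

text \<open>The opposite inequality is the known one for \<open>1 - f\<close>, because the total
  mass is exactly \<open>I (\<lambda>x. 1)\<close>.\<close>

lemma integral_representing_supported:
  assumes f: "supported K f"
  shows "(\<integral>x. f x \<partial>representing) = I f"
proof (rule antisym)
  have c: "continuous_on K f" using f by (simp add: supported_def)
  then have c': "continuous_on K (\<lambda>x. 1 - f x)" by (intro continuous_intros)
  have "supported K (\<lambda>x. 1 - f x)"
    using f c' by (auto simp: supported_def)
  then have "I (\<lambda>x. 1 - f x) \<le> (\<integral>x. 1 - f x \<partial>representing)"
    by (rule le_integral_representing)
  also have "\<dots> = I (\<lambda>x. 1) - (\<integral>x. f x \<partial>representing)"
    using integrable_representing[OF c] measure_representing_space
    by (simp add: space_representing)
  finally show "(\<integral>x. f x \<partial>representing) \<le> I f"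
    using add[OF c c'] by simp
qed (rule le_integral_representing[OF f])

proposition integral_representing:
  assumes c: "continuous_on K f"
  shows "(\<integral>x. f x \<partial>representing) = I f"
proof -
  obtain B where B: "0 < B" "\<And>x. x \<in> K \<Longrightarrow> \<bar>f x\<bar> \<le> B"
    using compact_abs_bound[OF compact_K c] by metis
  \<comment> \<open>An affine rescaling into \<open>[0, 1]\<close>. It is used in the form
    \<open>f + B = 2 * B * g\<close>, where all scalars are nonnegative, as \<open>scale\<close>
    demands.\<close>
  define g where "g x = (f x + B) / (2 * B)" for x
  have g: "supported K g"
    unfolding supported_def
  proof (intro conjI ballI)
    show "continuous_on K g"
      unfolding g_def[abs_def] using B(1) by (intro continuous_intros c) auto
    show "0 \<le> g x" "g x \<le> 1" if "x \<in> K" for x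
      using B(2)[OF that] B(1) by (auto simp: g_def field_simps)
  qed auto
  then have gc: "continuous_on K g" by (simp add: supported_def)
  have fg: "f x + B * 1 = 2 * B * g x" for x
    using B(1) by (simp add: g_def)
  have "I f + B * I (\<lambda>x. 1) = I (\<lambda>x. f x + B * 1)"
    using add[OF c, of "\<lambda>x. B * 1"] scale[of B "\<lambda>x. 1"] B(1) by simp
  also have "\<dots> = 2 * B * I g"
    unfolding fg using scale[OF _ gc, of "2 * B"] B(1) by simp
  also have "\<dots> = 2 * B * (\<integral>x. g x \<partial>representing)"
    by (simp add: integral_representing_supported[OF g])
  also have "\<dots> = (\<integral>x. f x + B * 1 \<partial>representing)"
    unfolding fg by simp
  also have "\<dots> = (\<integral>x. f x \<partial>representing) + B * I (\<lambda>x. 1)"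
    using integrable_representing[OF c] measure_representing_space
    by (simp add: space_representing)
  finally show ?thesis by simp
qed

end

text \<open>A Urysohn function fits between the indicators of \<open>C\<close> and of an open
  \<open>U\<close> whose \<open>N\<close>-measure exceeds that of \<open>C\<close> by less than
  \<open>e\<close>; the two integrals of this function agree.\<close>

lemma regular_measure_compact_le:
  assumes K: "compact K" "Hausdorff_space (top_of_set K)"
    and M: "regular_borel_measure K M" and N: "regular_borel_measure K N"
    and eq: "\<And>f :: _ \<Rightarrow> real. continuous_on K f \<Longrightarrow> (\<integral>x. f x \<partial>M) = (\<integral>x. f x \<partial>N)"
    and C: "compact C" "C \<subseteq> K"
  shows "emeasure M C \<le> emeasure N C"
proof (rule ennreal_le_epsilon)
  fix e :: real assume e: "0 < e"
  interpret M: finite_measure M using M by (simp add: regular_borel_measure_def)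
  interpret N: finite_measure N using N by (simp add: regular_borel_measure_def)
  have sM: "sets M = sets (borelK K)" and sN: "sets N = sets (borelK K)"
    using M N by (simp_all add: regular_borel_measure_def)
  have spaceN: "space N = K" "space M = K"
    using sets_eq_imp_space_eq[OF sN] sets_eq_imp_space_eq[OF sM] by (simp_all add: space_borelK)
  have "compactin (top_of_set K) C"
    using C by (simp add: compactin_subtopology)
  then have closC: "closedin (top_of_set K) C"
    using K(2) by (rule compactin_imp_closedin[rotated])
  then have CsN: "C \<in> sets (borelK K)" by (rule closedin_borelK)
  then have "(INF U\<in>{U. openin (top_of_set K) U \<and> C \<subseteq> U}. emeasure N U) = emeasure N C"
    using N CsN sN unfolding regular_borel_measure_def by metis
  also have "\<dots> < emeasure N C + ennreal e"
    using e by (simp add: N.emeasure_eq_measure ennreal_less_iff flip: ennreal_plus)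
  finally obtain U where U: "openin (top_of_set K) U" "C \<subseteq> U" "emeasure N U < emeasure N C + ennreal e"
    by (auto simp: INF_less_iff)
  have closU: "closedin (top_of_set K) (K - U)"
    using U(1) by (intro closedin_diff) auto
  obtain f :: "_ \<Rightarrow> real" where f: "continuous_on K f" "\<And>x. x \<in> K \<Longrightarrow> 0 \<le> f x \<and> f x \<le> 1"
    "\<And>x. x \<in> K - U \<Longrightarrow> f x = 0" "\<And>x. x \<in> C \<Longrightarrow> f x = 1"
    by (rule compact_Urysohn[OF K closU closC]) (use U(2) in auto)
  have Us: "U \<in> sets N" using U(1) by (simp add: sN openin_borelK)
  have "measure M C = (\<integral>x. indicator C x \<partial>M)"
    using C CsN by (simp add: spaceN Int_absorb2 Int_absorb1)
  also have "\<dots> \<le> (\<integral>x. f x \<partial>M)"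
  proof (rule integral_mono)
    show "integrable M (indicator C :: _ \<Rightarrow> real)"
      using CsN by (simp add: sM M.emeasure_eq_measure)
    show "integrable M f"
      by (rule integrable_continuous_borelK[OF K(1) M.finite_measure_axioms sM f(1)])
    show "indicator C x \<le> f x" if "x \<in> space M" for x
      using that f(2)[of x] f(4)[of x] by (auto simp: spaceN indicator_def)
  qed
  also have "\<dots> = (\<integral>x. f x \<partial>N)" by (rule eq[OF f(1)])
  also have "\<dots> \<le> (\<integral>x. indicator U x \<partial>N)"
  proof (rule integral_mono)
    show "integrable N (indicator U :: _ \<Rightarrow> real)"
      using Us by (simp add: N.emeasure_eq_measure)
    show "integrable N f"
      by (rule integrable_continuous_borelK[OF K(1) N.finite_measure_axioms sN f(1)])
    show "f x \<le> indicator U x" if "x \<in> space N" for x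
      using that f(2)[of x] f(3)[of x] by (auto simp: spaceN indicator_def)
  qed
  also have "\<dots> = measure N U"
    using sets.sets_into_space[OF Us] by (simp add: Int_absorb2 Int_absorb1)
  finally have "emeasure M C \<le> emeasure N U"
    by (simp add: M.emeasure_eq_measure N.emeasure_eq_measure)
  then show "emeasure M C \<le> emeasure N C + ennreal e"
    using U(3) by (meson le_less_trans less_imp_le)
qed

lemma regular_measure_eqI:
  assumes K: "compact K" "Hausdorff_space (top_of_set K)"
    and M: "regular_borel_measure K M" and N: "regular_borel_measure K N"
    and eq: "\<And>f :: _ \<Rightarrow> real. continuous_on K f \<Longrightarrow> (\<integral>x. f x \<partial>M) = (\<integral>x. f x \<partial>N)"
  shows "M = N"
proof (rule measure_eqI)
  show s: "sets M = sets N" using M N by (simp add: regular_borel_measure_def)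
  fix A assume A: "A \<in> sets M"
  have "space M = K"
    using M sets_eq_imp_space_eq[of M "borelK K"] by (simp add: regular_borel_measure_def space_borelK)
  then have AK: "A \<subseteq> K" using sets.sets_into_space[OF A] by simp
  have "emeasure M C = emeasure N C" if "compact C" "C \<subseteq> A" for C
    using regular_measure_compact_le[OF K M N eq, of C] regular_measure_compact_le[OF K N M eq[symmetric], of C]
      that AK by (simp add: order.antisym)
  then have "(SUP C\<in>{C. compact C \<and> C \<subseteq> A}. emeasure M C) = (SUP C\<in>{C. compact C \<and> C \<subseteq> A}. emeasure N C)"
    by (intro SUP_cong) auto
  then show "emeasure M A = emeasure N A"
    using A M N s by (simp add: regular_borel_measure_def)
qed

section \<open>Functionals on continuous convex functions\<close>

lemma Hausdorff_space_function: "Hausdorff_space (top_of_set (K :: ('a \<Rightarrow> real) set))"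
  unfolding euclidean_product_topology[symmetric]
  by (intro Hausdorff_space_subtopology) (simp add: Hausdorff_space_product_topology Hausdorff_space_euclidean)

section \<open>Uniform approximation by a lattice of functions\<close>

lemma compact_openin_finite_subcover:
  assumes K: "compact K" and V: "\<And>y. y \<in> K \<Longrightarrow> openin (top_of_set K) (V y)" "\<And>y. y \<in> K \<Longrightarrow> y \<in> V y"
  obtains J where "finite J" "J \<subseteq> K" "K \<subseteq> (\<Union>y\<in>J. V y)"
proof -
  have "\<exists>D\<subseteq>V ` K. finite D \<and> K \<subseteq> \<Union>D"
    using K[unfolded compact_eq_openin_cover, rule_format, of "V ` K"] V by blast
  then obtain D where D: "D \<subseteq> V ` K" "finite D" "K \<subseteq> \<Union>D" by blast
  from finite_subset_image[OF D(2,1)] obtain J where "J \<subseteq> K" "finite J" "D = V ` J" by blast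
  with D(3) that show thesis by blast
qed

text \<open>One induction serves both finite minima, with \<open>R\<close> as
  \<open>(\<le>)\<close>, and finite maxima, with \<open>R\<close> as \<open>(\<ge>)\<close>. That
  every value is attained at some index is what preserves interpolation under minima and the upper
  bound under maxima.\<close>

lemma finite_lattice_closed:
  fixes op :: "real \<Rightarrow> real \<Rightarrow> real"
  assumes J: "finite J" "J \<noteq> {}" and d: "\<And>j. j \<in> J \<Longrightarrow> d j \<in> D"
    and closed: "\<And>f g. f \<in> D \<Longrightarrow> g \<in> D \<Longrightarrow> (\<lambda>x. op (f x) (g x)) \<in> D"
    and op: "\<And>a b. op a b = a \<or> op a b = b"
    and le: "\<And>a b. R (op a b) a \<and> R (op a b) b" and refl: "\<And>a. R a a"
    and trans: "\<And>a b c. R a b \<Longrightarrow> R b c \<Longrightarrow> R a c"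
  shows "\<exists>g\<in>D. \<forall>x. (\<exists>j\<in>J. g x = d j x) \<and> (\<forall>j\<in>J. R (g x) (d j x))"
  using J d
proof (induction J rule: finite_ne_induct)
  case (singleton j)
  then show ?case using refl by (intro bexI[of _ "d j"]) auto
next
  case (insert j J)
  then obtain g where g: "g \<in> D" "\<And>x. \<exists>j\<in>J. g x = d j x" "\<And>x i. i \<in> J \<Longrightarrow> R (g x) (d i x)"
    by blast
  show ?case
  proof (rule bexI, intro allI conjI)
    show "(\<lambda>x. op (d j x) (g x)) \<in> D" using insert.prems g by (intro closed) auto
    fix x
    show "\<exists>i\<in>insert j J. op (d j x) (g x) = d i x"
      using op[of "d j x" "g x"] g(2)[of x] by auto
    show "\<forall>i\<in>insert j J. R (op (d j x) (g x)) (d i x)"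
      using le[of "d j x" "g x"] g(3)[of _ x] trans by blast
  qed
qed

text \<open>The Kakutani-Stone argument. For fixed \<open>x\<close>, a finite minimum of functions
  agreeing with \<open>f\<close> at \<open>x\<close> and at a second point stays below
  \<open>f + e\<close> and still has the value \<open>f x\<close> at \<open>x\<close>. A finite
  maximum of these over \<open>x\<close> also stays above \<open>f - e\<close>.\<close>

lemma lattice_dense:
  fixes f :: "'b::topological_space \<Rightarrow> real"
  assumes K: "compact K" "K \<noteq> {}"
    and cont: "\<And>d. d \<in> D \<Longrightarrow> continuous_on K d"
    and max: "\<And>f g. f \<in> D \<Longrightarrow> g \<in> D \<Longrightarrow> (\<lambda>x. max (f x) (g x)) \<in> D"
    and min: "\<And>f g. f \<in> D \<Longrightarrow> g \<in> D \<Longrightarrow> (\<lambda>x. min (f x) (g x)) \<in> D"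
    and inter: "\<And>x y. x \<in> K \<Longrightarrow> y \<in> K \<Longrightarrow> \<exists>d\<in>D. d x = f x \<and> d y = f y"
    and f: "continuous_on K f" and e: "0 < e"
  shows "\<exists>d\<in>D. \<forall>x\<in>K. \<bar>f x - d x\<bar> < e"
proof -
  have op: "openin (top_of_set K) {z \<in> K. 0 < h z}" if "continuous_on K h" for h :: "'b \<Rightarrow> real"
    using continuous_openin_preimage_gen[OF that, of "{0<..}"] by (simp add: vimage_def Int_def)
  have upper: "\<exists>g\<in>D. g x = f x \<and> (\<forall>z\<in>K. g z < f z + e)" if x: "x \<in> K" for x
  proof -
    have "\<forall>y\<in>K. \<exists>d. d \<in> D \<and> d x = f x \<and> d y = f y" using inter[OF x] by blast
    from bchoice[OF this] obtain d where d: "\<And>y. y \<in> K \<Longrightarrow> d y \<in> D"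
        "\<And>y. y \<in> K \<Longrightarrow> d y x = f x" "\<And>y. y \<in> K \<Longrightarrow> d y y = f y" by blast
    have "openin (top_of_set K) {z \<in> K. 0 < f z + e - d y z}" if "y \<in> K" for y
      by (intro op continuous_intros f cont d that)
    then obtain J where J: "finite J" "J \<subseteq> K" "K \<subseteq> (\<Union>y\<in>J. {z \<in> K. 0 < f z + e - d y z})"
      by (rule compact_openin_finite_subcover[OF K(1)]) (use d e in auto)
    have "J \<noteq> {}" using J K by auto
    have "\<exists>g\<in>D. \<forall>z. (\<exists>j\<in>J. g z = d j z) \<and> (\<forall>j\<in>J. g z \<le> d j z)"
    proof (rule finite_lattice_closed[where op = min and R = "(\<le>)", OF J(1) \<open>J \<noteq> {}\<close> _ min])
      show "d j \<in> D" if "j \<in> J" for j using that J(2) d(1) by auto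
    qed (auto simp: min_def)
    then obtain g where g: "g \<in> D" "\<And>z. \<exists>j\<in>J. g z = d j z" "\<And>z j. j \<in> J \<Longrightarrow> g z \<le> d j z"
      by blast
    have "g x = f x" using g(2)[of x] J(2) d(2) by auto
    moreover have "g z < f z + e" if "z \<in> K" for z
    proof -
      obtain j where "j \<in> J" "d j z < f z + e" using J(3) \<open>z \<in> K\<close> by force
      then show ?thesis using g(3)[of j z] by linarith
    qed
    ultimately show ?thesis using g(1) by blast
  qed
  then have "\<forall>x\<in>K. \<exists>g. g \<in> D \<and> g x = f x \<and> (\<forall>z\<in>K. g z < f z + e)" by blast
  from bchoice[OF this] obtain g where g: "\<And>x. x \<in> K \<Longrightarrow> g x \<in> D"
      "\<And>x. x \<in> K \<Longrightarrow> g x x = f x" "\<And>x z. x \<in> K \<Longrightarrow> z \<in> K \<Longrightarrow> g x z < f z + e" by blast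
  have "openin (top_of_set K) {z \<in> K. 0 < g x z - (f z - e)}" if "x \<in> K" for x
    by (intro op continuous_intros f cont g that)
  then obtain J where J: "finite J" "J \<subseteq> K" "K \<subseteq> (\<Union>x\<in>J. {z \<in> K. 0 < g x z - (f z - e)})"
    by (rule compact_openin_finite_subcover[OF K(1)]) (use g e in auto)
  have "J \<noteq> {}" using J K by auto
  have "\<exists>h\<in>D. \<forall>z. (\<exists>j\<in>J. h z = g j z) \<and> (\<forall>j\<in>J. h z \<ge> g j z)"
  proof (rule finite_lattice_closed[where op = max and R = "(\<ge>)", OF J(1) \<open>J \<noteq> {}\<close> _ max])
    show "g j \<in> D" if "j \<in> J" for j using that J(2) g(1) by auto
  qed (auto simp: max_def)
  then obtain h where h: "h \<in> D" "\<And>z. \<exists>j\<in>J. h z = g j z" "\<And>z j. j \<in> J \<Longrightarrow> g j z \<le> h z"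
    by blast
  have "\<bar>f z - h z\<bar> < e" if z: "z \<in> K" for z
  proof -
    obtain j where "j \<in> J" "f z - e < g j z" using J(3) z by force
    then have "f z - e < h z" using h(3)[of j z] by linarith
    moreover obtain i where "i \<in> J" "h z = g i z" using h(2) by blast
    then have "h z < f z + e" using g(3)[OF _ z] J(2) by auto
    ultimately show ?thesis by linarith
  qed
  with h(1) show ?thesis by blast
qed

section \<open>The cone of continuous convex functions\<close>

lemma ConI:
  assumes "continuous_on K f"
    "\<And>x y t. x \<in> K \<Longrightarrow> y \<in> K \<Longrightarrow> 0 \<le> t \<Longrightarrow> t \<le> 1 \<Longrightarrow> f (cmb t x y) \<le> t * f x + (1 - t) * f y"
  shows "f \<in> Con K"
  using assms by (simp add: Con_def)

lemma ConD:
  assumes "f \<in> Con K"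
  shows "continuous_on K f"
    and "x \<in> K \<Longrightarrow> y \<in> K \<Longrightarrow> 0 \<le> t \<Longrightarrow> t \<le> 1 \<Longrightarrow> f (cmb t x y) \<le> t * f x + (1 - t) * f y"
  using assms by (simp_all add: Con_def)

lemma Con_add:
  assumes f: "f \<in> Con K" and g: "g \<in> Con K"
  shows "(\<lambda>x. f x + g x) \<in> Con K"
proof (rule ConI)
  show "continuous_on K (\<lambda>x. f x + g x)"
    by (intro continuous_intros ConD(1)[OF f] ConD(1)[OF g])
  fix x y and t :: real assume *: "x \<in> K" "y \<in> K" "0 \<le> t" "t \<le> 1"
  show "f (cmb t x y) + g (cmb t x y) \<le> t * (f x + g x) + (1 - t) * (f y + g y)"
    using ConD(2)[OF f *] ConD(2)[OF g *] by (simp add: distrib_left)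
qed

lemma Con_scale:
  assumes f: "f \<in> Con K" and c: "0 \<le> c"
  shows "(\<lambda>x. c * f x) \<in> Con K"
proof (rule ConI)
  show "continuous_on K (\<lambda>x. c * f x)"
    by (intro continuous_intros ConD(1)[OF f])
  fix x y and t :: real assume *: "x \<in> K" "y \<in> K" "0 \<le> t" "t \<le> 1"
  show "c * f (cmb t x y) \<le> t * (c * f x) + (1 - t) * (c * f y)"
    using mult_left_mono[OF ConD(2)[OF f *] c] by (simp add: algebra_simps)
qed

lemma Con_max:
  assumes f: "f \<in> Con K" and g: "g \<in> Con K"
  shows "(\<lambda>x. max (f x) (g x)) \<in> Con K"
proof (rule ConI)
  show "continuous_on K (\<lambda>x. max (f x) (g x))"
    by (intro continuous_intros ConD(1)[OF f] ConD(1)[OF g])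
  fix x y and t :: real assume *: "x \<in> K" "y \<in> K" "0 \<le> t" "t \<le> 1"
  let ?r = "t * max (f x) (g x) + (1 - t) * max (f y) (g y)"
  have "t * f x + (1 - t) * f y \<le> ?r" "t * g x + (1 - t) * g y \<le> ?r"
    using * by (intro add_mono mult_left_mono; simp)+
  then show "max (f (cmb t x y)) (g (cmb t x y)) \<le> ?r"
    using ConD(2)[OF f *] ConD(2)[OF g *] by simp
qed

lemma Con_affine_coordinate: "(\<lambda>x. b + c * x a) \<in> Con K"
proof (rule ConI)
  have "continuous_on K (\<lambda>x. x a)"
    using continuous_on_product_coordinates[of a] continuous_on_subset by blast
  then show "continuous_on K (\<lambda>x. b + c * x a)"
    by (intro continuous_intros)
qed (simp add: cmb_def algebra_simps)

lemma Con_const: "(\<lambda>x. c) \<in> Con K"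
  using Con_affine_coordinate[of c 0] by simp

text \<open>Differences of convex functions form a lattice: the maximum of \<open>g1 - h1\<close>
  and \<open>g2 - h2\<close> is \<open>max (g1 + h2) (g2 + h1) - (h1 + h2)\<close>. Two distinct
  points differ in some coordinate, and an affine function of that coordinate takes prescribed
  values at them.\<close>

lemma Con_differences_dense:
  fixes K :: "('a \<Rightarrow> real) set"
  assumes K: "compact K" "K \<noteq> {}" and f: "continuous_on K f" and e: "0 < e"
  obtains g h where "g \<in> Con K" "h \<in> Con K" "\<And>x. x \<in> K \<Longrightarrow> \<bar>f x - (g x - h x)\<bar> < e"
proof -
  define D where "D = {\<lambda>x. g x - h x | g h. g \<in> Con K \<and> h \<in> Con K}"
  have D: "(\<lambda>x. g x - h x) \<in> D" if "g \<in> Con K" "h \<in> Con K" for g h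
    using that by (auto simp: D_def)
  have "\<exists>d\<in>D. \<forall>x\<in>K. \<bar>f x - d x\<bar> < e"
  proof (rule lattice_dense[OF K _ _ _ _ f e])
    show "continuous_on K d" if "d \<in> D" for d
      using that by (auto simp: D_def intro: continuous_on_diff ConD(1))
  next
    fix d1 d2 assume "d1 \<in> D" "d2 \<in> D"
    then obtain g1 h1 g2 h2 where d: "d1 = (\<lambda>x. g1 x - h1 x)" "d2 = (\<lambda>x. g2 x - h2 x)"
      and c: "g1 \<in> Con K" "h1 \<in> Con K" "g2 \<in> Con K" "h2 \<in> Con K"
      by (auto simp: D_def)
    have "(\<lambda>x. max (d1 x) (d2 x)) = (\<lambda>x. max (g1 x + h2 x) (g2 x + h1 x) - (h1 x + h2 x))"
      by (auto simp: d max_def)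
    then show "(\<lambda>x. max (d1 x) (d2 x)) \<in> D"
      using c by (simp only:) (intro D Con_max Con_add)
    have "(\<lambda>x. min (d1 x) (d2 x)) = (\<lambda>x. (g1 x + g2 x) - max (g1 x + h2 x) (g2 x + h1 x))"
      by (auto simp: d max_def min_def)
    then show "(\<lambda>x. min (d1 x) (d2 x)) \<in> D"
      using c by (simp only:) (intro D Con_max Con_add)
  next
    fix x y assume "x \<in> K" "y \<in> K"
    show "\<exists>d\<in>D. d x = f x \<and> d y = f y"
    proof (cases "x = y")
      case True
      then show ?thesis
        using D[OF Con_const[of "f x"] Con_const[of 0]] by auto
    next
      case False
      then obtain a where a: "x a \<noteq> y a" by auto
      define c where "c = (f y - f x) / (y a - x a)"
      have "(f x - c * x a) + c * y a = f x + c * (y a - x a)" by (simp add: algebra_simps)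
      also have "\<dots> = f y" using a by (simp add: c_def)
      finally show ?thesis
        using D[OF Con_affine_coordinate[of "f x - c * x a" c a] Con_const[of 0]]
        by (intro bexI[of _ "\<lambda>z. f x - c * x a + c * z a"]) simp_all
    qed
  qed
  then show thesis using that by (auto simp: D_def)
qed

text \<open>In this form the Choquet ordering is antisymmetric on regular measures.\<close>

lemma regular_measure_eqI_Con:
  fixes K :: "('a \<Rightarrow> real) set"
  assumes K: "compact K" "K \<noteq> {}"
    and M: "regular_borel_measure K M" and N: "regular_borel_measure K N"
    and eq: "\<And>f. f \<in> Con K \<Longrightarrow> (\<integral>x. f x \<partial>M) = (\<integral>x. f x \<partial>N)"
  shows "M = N"
proof (rule regular_measure_eqI[OF K(1) Hausdorff_space_function M N])
  fix f :: "('a \<Rightarrow> real) \<Rightarrow> real" assume f: "continuous_on K f"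
  have close: "\<bar>(\<integral>x. f x \<partial>M') - ((\<integral>x. g x \<partial>M') - (\<integral>x. h x \<partial>M'))\<bar> \<le> e * measure M' K"
    if M': "regular_borel_measure K M'" and gh: "g \<in> Con K" "h \<in> Con K"
      and close: "\<And>x. x \<in> K \<Longrightarrow> \<bar>f x - (g x - h x)\<bar> < e" for M' g h e
  proof -
    have s: "sets M' = sets (borelK K)" and fin: "finite_measure M'"
      using M' by (simp_all add: regular_borel_measure_def)
    interpret finite_measure M' by fact
    have sp: "space M' = K" using sets_eq_imp_space_eq[OF s] by (simp add: space_borelK)
    have i: "integrable M' k" if "continuous_on K k" for k :: "('a \<Rightarrow> real) \<Rightarrow> real"
      by (rule integrable_continuous_borelK[OF K(1) fin s that])
    have c: "continuous_on K g" "continuous_on K h" using gh by (auto dest: ConD)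
    have "\<bar>(\<integral>x. f x \<partial>M') - ((\<integral>x. g x \<partial>M') - (\<integral>x. h x \<partial>M'))\<bar> = \<bar>\<integral>x. f x - (g x - h x) \<partial>M'\<bar>"
      using i[OF f] i[OF c(1)] i[OF c(2)] by simp
    also have "\<dots> \<le> (\<integral>x. \<bar>f x - (g x - h x)\<bar> \<partial>M')" by (rule integral_abs_bound)
    also have "\<dots> \<le> (\<integral>x. e \<partial>M')"
      using close i[OF f] i[OF c(1)] i[OF c(2)]
      by (intro integral_mono integrable_abs Bochner_Integration.integrable_diff) (auto simp: sp less_imp_le)
    also have "\<dots> = e * measure M' K" by (simp add: sp)
    finally show ?thesis .
  qed
  define c where "c = measure M K + measure N K"
  have "\<bar>(\<integral>x. f x \<partial>M) - (\<integral>x. f x \<partial>N)\<bar> \<le> 0 + d" if d: "0 < d" for d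
  proof -
    define e where "e = d / (1 + c)"
    have "0 \<le> c" by (simp add: c_def)
    then have e: "0 < e" "e * c \<le> d" using d by (auto simp: e_def field_simps)
    obtain g h where gh: "g \<in> Con K" "h \<in> Con K" "\<And>x. x \<in> K \<Longrightarrow> \<bar>f x - (g x - h x)\<bar> < e"
      using Con_differences_dense[OF K f e(1)] by metis
    show ?thesis
      using close[OF M gh] close[OF N gh] eq[OF gh(1)] eq[OF gh(2)] e(2) by (simp add: distrib_left c_def)
  qed
  then have "\<bar>(\<integral>x. f x \<partial>M) - (\<integral>x. f x \<partial>N)\<bar> \<le> 0" by (rule field_le_epsilon)
  then show "(\<integral>x. f x \<partial>M) = (\<integral>x. f x \<partial>N)" by simp
qed

section \<open>Extension from convex to continuous functions\<close>

locale Con_functional =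
  fixes K :: "('a \<Rightarrow> real) set" and L :: "(('a \<Rightarrow> real) \<Rightarrow> real) \<Rightarrow> real"
  assumes compact_K: "compact K" and nonempty: "K \<noteq> {}"
    and add: "\<And>f g. f \<in> Con K \<Longrightarrow> g \<in> Con K \<Longrightarrow> L (\<lambda>x. f x + g x) = L f + L g"
    and scale: "\<And>c f. 0 \<le> c \<Longrightarrow> f \<in> Con K \<Longrightarrow> L (\<lambda>x. c * f x) = c * L f"
    and mono: "\<And>f g. f \<in> Con K \<Longrightarrow> g \<in> Con K \<Longrightarrow> (\<And>x. x \<in> K \<Longrightarrow> f x \<le> g x) \<Longrightarrow> L f \<le> L g"
    and one: "L (\<lambda>x. 1) = 1"
begin

text \<open>An upper integral with differences of convex functions as majorants. An infimum gives a
  value to every \<open>f\<close> at once, with no choice of approximating differences.\<close>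

definition ext :: "(('a \<Rightarrow> real) \<Rightarrow> real) \<Rightarrow> real" where
  "ext f = Inf {L g - L h | g h. g \<in> Con K \<and> h \<in> Con K \<and> (\<forall>x\<in>K. f x \<le> g x - h x)}"

text \<open>Carrying \<open>h\<close> and \<open>h'\<close> to the opposite sides leaves an
  inequality between convex functions, where monotonicity of \<open>L\<close> applies. With
  \<open>e = 0\<close> it shows that \<open>L g - L h\<close> depends only on
  \<open>g - h\<close>.\<close>

lemma difference_le:
  assumes c: "g \<in> Con K" "h \<in> Con K" "g' \<in> Con K" "h' \<in> Con K" "0 \<le> e"
    and le: "\<And>x. x \<in> K \<Longrightarrow> g x - h x \<le> g' x - h' x + e"
  shows "L g - L h \<le> L g' - L h' + e"
proof -
  have "L (\<lambda>x. g x + h' x) \<le> L (\<lambda>x. g' x + (h x + e * 1))"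
  proof (rule mono)
    show "g x + h' x \<le> g' x + (h x + e * 1)" if "x \<in> K" for x
      using le[OF that] by simp
  qed (intro Con_add Con_scale Con_const c)+
  also have "\<dots> = L g' + (L h + e)"
    using add[OF c(3) Con_add[OF c(2) Con_scale[OF Con_const c(5)]], of 1]
      add[OF c(2) Con_scale[OF Con_const c(5)], of 1] scale[OF c(5) Con_const, of 1] one
    by simp
  finally show ?thesis using add[OF c(1,4)] by simp
qed

lemma ext_le:
  assumes f: "continuous_on K f" and c: "g \<in> Con K" "h \<in> Con K" and le: "\<And>x. x \<in> K \<Longrightarrow> f x \<le> g x - h x"
  shows "ext f \<le> L g - L h"
  unfolding ext_def
proof (rule cInf_lower)
  obtain B where B: "\<And>x. x \<in> K \<Longrightarrow> \<bar>f x\<bar> \<le> B" using compact_abs_bound[OF compact_K f] by metis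
  have "L (\<lambda>x. - B) - L (\<lambda>x. 0) \<le> L g - L h"
    if c: "g \<in> Con K" "h \<in> Con K" "\<forall>x\<in>K. f x \<le> g x - h x" for g h
  proof -
    have "- B \<le> g x - h x" if "x \<in> K" for x
      using B[OF that] c(3) that by (smt (verit))
    then show ?thesis
      using difference_le[OF Con_const[of "- B"] Con_const[of 0] c(1,2), of 0] by simp
  qed
  then show "bdd_below {L g - L h |g h. g \<in> Con K \<and> h \<in> Con K \<and> (\<forall>x\<in>K. f x \<le> g x - h x)}"
    by (intro bdd_belowI[of _ "L (\<lambda>x. - B) - L (\<lambda>x. 0)"]) auto
qed (use assms in blast)

lemma ext_ge:
  assumes f: "continuous_on K f" and c: "g \<in> Con K" "h \<in> Con K" "0 \<le> e"
    and le: "\<And>x. x \<in> K \<Longrightarrow> g x - h x \<le> f x + e"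
  shows "L g - L h - e \<le> ext f"
  unfolding ext_def
proof (rule cInf_greatest)
  obtain B where B: "\<And>x. x \<in> K \<Longrightarrow> \<bar>f x\<bar> \<le> B" using compact_abs_bound[OF compact_K f] by metis
  then have "\<forall>x\<in>K. f x \<le> B - 0" by force
  then have "L (\<lambda>x. B) - L (\<lambda>x. 0) \<in> {L g - L h |g h. g \<in> Con K \<and> h \<in> Con K \<and> (\<forall>x\<in>K. f x \<le> g x - h x)}"
    using Con_const by blast
  then show "{L g - L h |g h. g \<in> Con K \<and> h \<in> Con K \<and> (\<forall>x\<in>K. f x \<le> g x - h x)} \<noteq> {}" by blast
next
  fix r assume "r \<in> {L g - L h |g h. g \<in> Con K \<and> h \<in> Con K \<and> (\<forall>x\<in>K. f x \<le> g x - h x)}"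
  then obtain g' h' where r: "r = L g' - L h'" "g' \<in> Con K" "h' \<in> Con K" "\<And>x. x \<in> K \<Longrightarrow> f x \<le> g' x - h' x"
    by blast
  have "L g - L h \<le> L g' - L h' + e"
    by (rule difference_le) (use c r le in \<open>force+\<close>)
  then show "L g - L h - e \<le> r" by (simp add: r)
qed

lemma ext_Con: "f \<in> Con K \<Longrightarrow> ext f = L f"
proof -
  assume f: "f \<in> Con K"
  have "L (\<lambda>x. 0) = 0" using scale[OF _ Con_const, of 0] by simp
  then show ?thesis
    using ext_le[OF ConD(1)[OF f] f Con_const[of 0]] ext_ge[OF ConD(1)[OF f] f Con_const[of 0], of 0]
    by simp
qed

text \<open>Uniform errors pass to \<open>ext\<close> unchanged, since \<open>L\<close> maps the
  constant \<open>e\<close> to \<open>e\<close>. This transports the laws of \<open>L\<close> from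
  differences to their uniform limits.\<close>

lemma ext_approx:
  assumes f: "continuous_on K f" and c: "g \<in> Con K" "h \<in> Con K"
    and close: "\<And>x. x \<in> K \<Longrightarrow> \<bar>f x - (g x - h x)\<bar> \<le> e" and e: "0 \<le> e"
  shows "\<bar>ext f - (L g - L h)\<bar> \<le> e"
proof -
  have "ext f \<le> L (\<lambda>x. g x + e * 1) - L h"
  proof (rule ext_le[OF f _ c(2)])
    show "(\<lambda>x. g x + e * 1) \<in> Con K" by (intro Con_add Con_scale Con_const c e)
    show "f x \<le> g x + e * 1 - h x" if "x \<in> K" for x using close[OF that] by simp
  qed
  also have "L (\<lambda>x. g x + e * 1) = L g + e"
    using add[OF c(1) Con_scale[OF Con_const e], of 1] scale[OF e Con_const, of 1] one by simp
  finally have "ext f \<le> L g + e - L h" .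
  moreover have "L g - L h - e \<le> ext f"
  proof (rule ext_ge[OF f c e])
    show "g x - h x \<le> f x + e" if "x \<in> K" for x using close[OF that] by simp
  qed
  ultimately show ?thesis by simp
qed

lemma ext_approximations:
  assumes f: "continuous_on K f" and e: "0 < e"
  obtains g h where "g \<in> Con K" "h \<in> Con K" "\<And>x. x \<in> K \<Longrightarrow> \<bar>f x - (g x - h x)\<bar> \<le> e"
    "\<bar>ext f - (L g - L h)\<bar> \<le> e"
proof -
  obtain g h where gh: "g \<in> Con K" "h \<in> Con K" "\<And>x. x \<in> K \<Longrightarrow> \<bar>f x - (g x - h x)\<bar> < e"
    using Con_differences_dense[OF compact_K nonempty f e] by metis
  show thesis
    by (rule that[OF gh(1,2)]) (use gh e ext_approx[OF f gh(1,2), of e] in \<open>force+\<close>)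
qed

lemma positive_functional_ext: "positive_functional K ext"
proof
  show "compact K" by (rule compact_K)
  show "Hausdorff_space (top_of_set K)" by (rule Hausdorff_space_function)
next
  fix f1 f2 :: "('a \<Rightarrow> real) \<Rightarrow> real" assume f1: "continuous_on K f1" and f2: "continuous_on K f2"
  have "\<bar>ext (\<lambda>x. f1 x + f2 x) - (ext f1 + ext f2)\<bar> \<le> 0 + d" if "0 < d" for d
  proof -
    \<comment> \<open>Each of the two functions contributes its error twice: once in approximating
      the sum and once in its own value of \<open>ext\<close>.\<close>
    have e: "0 < d / 4" using that by simp
    obtain g1 h1 where 1: "g1 \<in> Con K" "h1 \<in> Con K" "\<And>x. x \<in> K \<Longrightarrow> \<bar>f1 x - (g1 x - h1 x)\<bar> \<le> d / 4"
      "\<bar>ext f1 - (L g1 - L h1)\<bar> \<le> d / 4" using ext_approximations[OF f1 e] by blast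
    obtain g2 h2 where 2: "g2 \<in> Con K" "h2 \<in> Con K" "\<And>x. x \<in> K \<Longrightarrow> \<bar>f2 x - (g2 x - h2 x)\<bar> \<le> d / 4"
      "\<bar>ext f2 - (L g2 - L h2)\<bar> \<le> d / 4" using ext_approximations[OF f2 e] by blast
    have "\<bar>ext (\<lambda>x. f1 x + f2 x) - (L (\<lambda>x. g1 x + g2 x) - L (\<lambda>x. h1 x + h2 x))\<bar> \<le> d / 2"
    proof (rule ext_approx)
      show "\<bar>f1 x + f2 x - (g1 x + g2 x - (h1 x + h2 x))\<bar> \<le> d / 2" if "x \<in> K" for x
        using 1(3)[OF that] 2(3)[OF that] by linarith
    qed (use \<open>0 < d\<close> in \<open>simp_all add: continuous_on_add f1 f2 Con_add 1 2\<close>)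
    then show ?thesis
      using 1(4) 2(4) add[OF 1(1) 2(1)] add[OF 1(2) 2(2)] by linarith
  qed
  then have "\<bar>ext (\<lambda>x. f1 x + f2 x) - (ext f1 + ext f2)\<bar> \<le> 0" by (rule field_le_epsilon)
  then show "ext (\<lambda>x. f1 x + f2 x) = ext f1 + ext f2" by simp
next
  fix c :: real and f :: "('a \<Rightarrow> real) \<Rightarrow> real" assume c: "0 \<le> c" and f: "continuous_on K f"
  have "\<bar>ext (\<lambda>x. c * f x) - c * ext f\<bar> \<le> 0 + d" if d: "0 < d" for d
  proof -
    \<comment> \<open>Two errors of size \<open>c * e\<close> arise; the summand 1 covers
      \<open>c = 0\<close>.\<close>
    define e where "e = d / (2 * (1 + c))"
    have e: "0 < e" "2 * (c * e) \<le> d" using c d by (auto simp: e_def field_simps)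
    obtain g h where gh: "g \<in> Con K" "h \<in> Con K" "\<And>x. x \<in> K \<Longrightarrow> \<bar>f x - (g x - h x)\<bar> \<le> e"
      "\<bar>ext f - (L g - L h)\<bar> \<le> e" using ext_approximations[OF f e(1)] by blast
    have cmul: "\<bar>c * a - c * b\<bar> \<le> c * e" if "\<bar>a - b\<bar> \<le> e" for a b
      using mult_left_mono[OF that c] c by (simp add: abs_mult flip: right_diff_distrib)
    have "\<bar>ext (\<lambda>x. c * f x) - (L (\<lambda>x. c * g x) - L (\<lambda>x. c * h x))\<bar> \<le> c * e"
    proof (rule ext_approx)
      show "\<bar>c * f x - (c * g x - c * h x)\<bar> \<le> c * e" if "x \<in> K" for x
        using cmul[OF gh(3)[OF that]] by (simp add: right_diff_distrib)
    qed (use c e in \<open>simp_all add: continuous_on_mult_left f Con_scale gh\<close>)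
    moreover have "\<bar>c * ext f - c * (L g - L h)\<bar> \<le> c * e" by (rule cmul[OF gh(4)])
    moreover have "L (\<lambda>x. c * g x) - L (\<lambda>x. c * h x) = c * (L g - L h)"
      by (simp add: scale[OF c] gh right_diff_distrib)
    ultimately show ?thesis using e(2) by linarith
  qed
  then have "\<bar>ext (\<lambda>x. c * f x) - c * ext f\<bar> \<le> 0" by (rule field_le_epsilon)
  then show "ext (\<lambda>x. c * f x) = c * ext f" by simp
next
  fix f1 f2 :: "('a \<Rightarrow> real) \<Rightarrow> real" assume f1: "continuous_on K f1" and f2: "continuous_on K f2"
    and le: "\<And>x. x \<in> K \<Longrightarrow> f1 x \<le> f2 x"
  have "ext f1 \<le> ext f2 + d" if "0 < d" for d
  proof -
    have e: "0 < d / 4" using that by simp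
    obtain g1 h1 where 1: "g1 \<in> Con K" "h1 \<in> Con K" "\<And>x. x \<in> K \<Longrightarrow> \<bar>f1 x - (g1 x - h1 x)\<bar> \<le> d / 4"
      "\<bar>ext f1 - (L g1 - L h1)\<bar> \<le> d / 4" using ext_approximations[OF f1 e] by blast
    have "L g1 - L h1 - d / 4 \<le> ext f2"
    proof (rule ext_ge[OF f2 1(1,2)])
      show "g1 x - h1 x \<le> f2 x + d / 4" if "x \<in> K" for x
        using 1(3)[OF that] le[OF that] by linarith
    qed (use e in simp)
    then show ?thesis using 1(4) e by linarith
  qed
  then show "ext f1 \<le> ext f2" by (rule field_le_epsilon)
qed

proposition representing_measure_exists:
  obtains M where "regular_borel_measure K M" "\<And>f. f \<in> Con K \<Longrightarrow> (\<integral>x. f x \<partial>M) = L f"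
proof -
  interpret ext: positive_functional K ext by (rule positive_functional_ext)
  show thesis
    using that ext.regular_representing ext.integral_representing[OF ConD(1)] ext_Con by metis
qed

end

section \<open>States on pseudo effect algebras with (RDP)\<close>

locale pseudo_effect_algebra_RDP =
  fixes pe :: "'a \<Rightarrow> 'a \<Rightarrow> 'a option" and z u :: 'a
  assumes pea: "pseudo_effect_algebra pe z u" and RDP: "RDP pe"
begin

lemma assoc: "(pe a b \<bind> (\<lambda>x. pe x c)) = (pe b c \<bind> (\<lambda>y. pe a y))"
  using pea unfolding pseudo_effect_algebra_def by blast

lemma assoc_right:
  assumes "pe a b = Some x" "pe x c = Some y"
  obtains w where "pe b c = Some w" "pe a w = Some y"
  using assoc[of a b c] assms by (cases "pe b c") auto

lemma assoc_left:
  assumes "pe b c = Some w" "pe a w = Some y"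
  obtains x where "pe a b = Some x" "pe x c = Some y"
  using assoc[of a b c] assms by (cases "pe a b") auto

lemma right_complement: "\<exists>!d. pe a d = Some u" and left_complement: "\<exists>!e. pe e a = Some u"
  using pea unfolding pseudo_effect_algebra_def by blast+

text \<open>The unit has complements on both sides, and axiom (iv) forces them to be
  \<open>z\<close>.\<close>

lemma unit_zero: "pe u z = Some u" "pe z u = Some u"
proof -
  have *: "a = z" if "pe u a = Some u \<or> pe a u = Some u" for a
    using pea that unfolding pseudo_effect_algebra_def by (metis option.distinct(1))
  obtain d e where "pe u d = Some u" "pe e u = Some u"
    using right_complement[of u] left_complement[of u] by blast
  then show "pe u z = Some u" "pe z u = Some u"
    using *[of d] *[of e] by auto
qed

text \<open>If \<open>e + a = 1\<close>, then \<open>1 + 0 = 1\<close> reassociates to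
  \<open>e + (a + 0) = 1\<close>, and right complements of \<open>e\<close> are unique.\<close>

lemma zero_right: "pe a z = Some a"
proof -
  obtain e where e: "pe e a = Some u" using left_complement by blast
  obtain w where "pe a z = Some w" "pe e w = Some u"
    by (rule assoc_right[OF e unit_zero(1)])
  with e show ?thesis using right_complement[of e] by auto
qed

lemma zero_left: "pe z a = Some a"
proof -
  obtain e where e: "pe a e = Some u" using right_complement by blast
  obtain w where "pe z a = Some w" "pe w e = Some u"
    by (rule assoc_left[OF e unit_zero(2)])
  with e show ?thesis using left_complement[of e] by auto
qed

section \<open>The cone over the state space\<close>

text \<open>States without normalisation. Since \<open>m u\<close> bounds \<open>m\<close>, the
  elements are the zero map and the positive multiples of states.\<close>

definition additive_cone :: "('a \<Rightarrow> real) set" where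
  "additive_cone = {m. (\<forall>a. 0 \<le> m a) \<and> (\<forall>a b c. pe a b = Some c \<longrightarrow> m c = m a + m b)}"

lemma cone_nonneg: "m \<in> additive_cone \<Longrightarrow> 0 \<le> m a"
  by (simp add: additive_cone_def)

lemma cone_additive: "m \<in> additive_cone \<Longrightarrow> pe a b = Some c \<Longrightarrow> m c = m a + m b"
  by (simp add: additive_cone_def)

lemma cone_le_unit: "m \<in> additive_cone \<Longrightarrow> m a \<le> m u"
  using right_complement[of a] cone_additive cone_nonneg by (metis le_add_same_cancel1)

lemma cone_zero: "m \<in> additive_cone \<Longrightarrow> m z = 0"
  using cone_additive[OF _ zero_right, of m z] by simp

lemma cone_sum: "(\<And>i. i \<in> I \<Longrightarrow> m i \<in> additive_cone) \<Longrightarrow> (\<lambda>a. \<Sum>i\<in>I. m i a) \<in> additive_cone"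
  by (simp add: additive_cone_def sum_nonneg sum.distrib)

lemma states_iff: "s \<in> states pe u \<longleftrightarrow> s \<in> additive_cone \<and> s u = 1"
  by (auto simp: states_def is_state_def additive_cone_def)

lemma normalized_in_states:
  assumes "m \<in> additive_cone" "m u \<noteq> 0"
  shows "(\<lambda>a. m a / m u) \<in> states pe u"
  using assms cone_nonneg[of m u] by (auto simp: states_iff additive_cone_def add_divide_distrib)

text \<open>By Tychonoff the cube of maps into \<open>[0, 1]\<close> is compact, and every condition
  on a state is closed because it involves finitely many coordinates.\<close>

lemma compact_states: "compact (states pe u)"
proof -
  have "compactin (product_topology (\<lambda>i::'a. euclideanreal) UNIV) (PiE UNIV (\<lambda>i. {0..1}))"
    by (subst compactin_PiE) auto
  then have c: "compact (PiE (UNIV :: 'a set) (\<lambda>i. {0..1::real}))"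
    by (simp add: euclidean_product_topology)
  have "closed (\<Inter>a. {s :: 'a \<Rightarrow> real. 0 \<le> s a})"
    "closed (\<Inter>a. \<Inter>b. \<Inter>c\<in>{c. pe a b = Some c}. {s :: 'a \<Rightarrow> real. s c = s a + s b})"
    "closed {s :: 'a \<Rightarrow> real. s u = 1}"
    by (intro closed_INT ballI closed_Collect_le closed_Collect_eq continuous_on_add
        continuous_on_const continuous_on_product_coordinates)+
  then have "closed ((\<Inter>a. {s :: 'a \<Rightarrow> real. 0 \<le> s a})
      \<inter> (\<Inter>a. \<Inter>b. \<Inter>c\<in>{c. pe a b = Some c}. {s :: 'a \<Rightarrow> real. s c = s a + s b}) \<inter> {s. s u = 1})"
    by (intro closed_Int)
  also have "\<dots> = states pe u"
    by (auto simp: states_def is_state_def)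
  finally have "closed (states pe u)" .
  moreover have "states pe u \<subseteq> PiE UNIV (\<lambda>i. {0..1})"
    using cone_nonneg cone_le_unit by (force simp: states_iff)
  ultimately show ?thesis
    using compact_Int_closed[OF c] by (metis inf.absorb_iff2)
qed

section \<open>Infima of positive additive maps\<close>

text \<open>The Riesz-Kantorovich formula for the infimum of two additive functionals. The order of
  the summands matters here: \<open>m\<close> is evaluated on the left one and \<open>p\<close> on
  the right one.\<close>

definition glb :: "('a \<Rightarrow> real) \<Rightarrow> ('a \<Rightarrow> real) \<Rightarrow> 'a \<Rightarrow> real" where
  "glb m p a = Inf {m b + p c | b c. pe b c = Some a}"

lemma glb_le:
  assumes "m \<in> additive_cone" "p \<in> additive_cone" "pe b c = Some a"
  shows "glb m p a \<le> m b + p c"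
  unfolding glb_def
proof (rule cInf_lower)
  show "bdd_below {m b + p c | b c. pe b c = Some a}"
    using assms cone_nonneg by (intro bdd_belowI[of _ 0]) (auto intro!: add_nonneg_nonneg)
qed (use assms in auto)

lemma glb_ge:
  assumes "\<And>b c. pe b c = Some a \<Longrightarrow> r \<le> m b + p c"
  shows "r \<le> glb m p a"
  unfolding glb_def using zero_right[of a] by (intro cInf_greatest) (auto intro: assms)

text \<open>Axiom (iii) lets two neighbouring summands be interchanged at the price of replacing one of
  them by an element on which every additive map takes the same value.\<close>

lemma interchange:
  assumes "pe a1 a2 = Some a" "pe b1 b2 = Some b" "pe a b = Some c"
  obtains b1' ab1 ab2 where "pe a1 b1' = Some ab1" "pe a2 b2 = Some ab2" "pe ab1 ab2 = Some c"
    "\<And>m. m \<in> additive_cone \<Longrightarrow> m b1' = m b1"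
proof -
  obtain w where w: "pe a2 b = Some w" "pe a1 w = Some c"
    by (rule assoc_right[OF assms(1,3)])
  obtain x where x: "pe a2 b1 = Some x" "pe x b2 = Some w"
    by (rule assoc_left[OF assms(2) w(1)])
  have "pe a2 b1 \<noteq> None" using x by simp
  then obtain d where d: "pe d a2 = Some x"
    using pea x(1) unfolding pseudo_effect_algebra_def by (metis option.sel)
  have eq: "m d = m b1" if "m \<in> additive_cone" for m
    using cone_additive[OF that d] cone_additive[OF that x(1)] by simp
  obtain y where y: "pe a2 b2 = Some y" "pe d y = Some w"
    by (rule assoc_right[OF d x(2)])
  obtain v where v: "pe a1 d = Some v" "pe v y = Some c"
    by (rule assoc_left[OF y(2) w(2)])
  show thesis by (rule that[OF v(1) y(1) v(2) eq])
qed

text \<open>For subadditivity, \<open>interchange\<close> merges decompositions of \<open>a\<close>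
  and \<open>b\<close> into one of \<open>c\<close> with the \<open>m\<close>-parts on the left. For
  superadditivity, (RDP) splits a decomposition of \<open>c\<close> into one of \<open>a\<close> and
  one of \<open>b\<close>.\<close>

lemma glb_in_cone:
  assumes m: "m \<in> additive_cone" and p: "p \<in> additive_cone"
  shows "glb m p \<in> additive_cone"
proof -
  have "0 \<le> glb m p a" for a
    using m p cone_nonneg by (intro glb_ge) (auto intro: add_nonneg_nonneg)
  moreover have "glb m p c = glb m p a + glb m p b" if c: "pe a b = Some c" for a b c
  proof (rule antisym)
    have "glb m p c - (m b1 + p b2) \<le> glb m p a" if b: "pe b1 b2 = Some b" for b1 b2
    proof (rule glb_ge)
      fix a1 a2 assume a: "pe a1 a2 = Some a"
      obtain b1' ab1 ab2 where *: "pe a1 b1' = Some ab1" "pe a2 b2 = Some ab2" "pe ab1 ab2 = Some c"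
          "m b1' = m b1"
        using interchange[OF a b c] m by metis
      then show "glb m p c - (m b1 + p b2) \<le> m a1 + p a2"
        using glb_le[OF m p *(3)] cone_additive[OF m *(1)] cone_additive[OF p *(2)] by simp
    qed
    then have "glb m p c - glb m p a \<le> glb m p b"
      by (intro glb_ge) (simp add: algebra_simps)
    then show "glb m p c \<le> glb m p a + glb m p b" by simp
  next
    show "glb m p a + glb m p b \<le> glb m p c"
    proof (rule glb_ge)
      fix c1 c2 assume c12: "pe c1 c2 = Some c"
      then obtain d1 d2 d3 d4 where d: "pe d1 d2 = Some a" "pe d3 d4 = Some b"
          "pe d1 d3 = Some c1" "pe d2 d4 = Some c2"
        using RDP c unfolding RDP_def by (metis option.distinct(1))
      then show "glb m p a + glb m p b \<le> m c1 + p c2"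
        using glb_le[OF m p d(1)] glb_le[OF m p d(2)] cone_additive[OF m d(3)] cone_additive[OF p d(4)]
        by simp
    qed
  qed
  ultimately show ?thesis by (simp add: additive_cone_def)
qed

lemma cone_diff:
  assumes "m \<in> additive_cone" "p \<in> additive_cone" "\<And>a. p a \<le> m a"
  shows "(\<lambda>a. m a - p a) \<in> additive_cone"
  using assms by (simp add: additive_cone_def)

section \<open>Common refinements of decompositions in the cone\<close>

text \<open>The corner \<open>q11\<close> is the infimum of \<open>m1\<close> and \<open>p1\<close>;
  the other entries are differences. Only \<open>q22\<close> needs an argument: the additive map
  \<open>p1 - m2\<close> lies below both \<open>m1\<close> and \<open>p1\<close>, hence below their
  infimum.\<close>

lemma cone_refinement_2x2:
  assumes m: "m1 \<in> additive_cone" "m2 \<in> additive_cone" and p: "p1 \<in> additive_cone" "p2 \<in> additive_cone"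
    and eq: "\<And>a. m1 a + m2 a = p1 a + p2 a"
  obtains q11 q12 q21 q22 where "q11 \<in> additive_cone" "q12 \<in> additive_cone" "q21 \<in> additive_cone" "q22 \<in> additive_cone"
    "\<And>a. m1 a = q11 a + q12 a" "\<And>a. m2 a = q21 a + q22 a"
    "\<And>a. p1 a = q11 a + q21 a" "\<And>a. p2 a = q12 a + q22 a"
proof -
  let ?g = "glb m1 p1"
  have g: "?g \<in> additive_cone" by (rule glb_in_cone[OF m(1) p(1)])
  have le: "?g a \<le> m1 a" "?g a \<le> p1 a" for a
    using glb_le[OF m(1) p(1) zero_right[of a]] glb_le[OF m(1) p(1) zero_left[of a]]
      cone_zero[OF m(1)] cone_zero[OF p(1)] by simp_all
  have ge: "p1 a - m2 a \<le> ?g a" for a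
  proof (rule glb_ge)
    fix b c assume bc: "pe b c = Some a"
    have "p1 b - m2 b \<le> m1 b" using eq[of b] cone_nonneg[OF p(2), of b] by linarith
    moreover have "0 \<le> m2 c" by (rule cone_nonneg[OF m(2)])
    ultimately show "p1 a - m2 a \<le> m1 b + p1 c"
      using cone_additive[OF m(2) bc] cone_additive[OF p(1) bc] by linarith
  qed
  have 12: "(\<lambda>a. m1 a - ?g a) \<in> additive_cone" by (rule cone_diff[OF m(1) g le(1)])
  have 21: "(\<lambda>a. p1 a - ?g a) \<in> additive_cone" by (rule cone_diff[OF p(1) g le(2)])
  have 22: "(\<lambda>a. m2 a - (p1 a - ?g a)) \<in> additive_cone"
  proof (rule cone_diff[OF m(2) 21])
    show "p1 a - ?g a \<le> m2 a" for a using ge[of a] by linarith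
  qed
  show thesis
  proof (rule that[OF g 12 21 22])
    show "p2 a = m1 a - ?g a + (m2 a - (p1 a - ?g a))" for a using eq[of a] by linarith
  qed simp_all
qed

text \<open>The 2x2 case separates \<open>p j\<close> from the sum of the remaining columns; the two
  remainders \<open>q12\<close> and \<open>q22\<close> are then split by the induction
  hypothesis.\<close>

lemma cone_refinement_2xn:
  assumes "finite J" "m \<in> additive_cone" "m' \<in> additive_cone" "\<And>j. j \<in> J \<Longrightarrow> p j \<in> additive_cone"
    and "\<And>a. m a + m' a = (\<Sum>j\<in>J. p j a)"
  shows "\<exists>q q'. (\<forall>j\<in>J. q j \<in> additive_cone \<and> q' j \<in> additive_cone \<and> (\<forall>a. p j a = q j a + q' j a)) \<and>
    (\<forall>a. m a = (\<Sum>j\<in>J. q j a) \<and> m' a = (\<Sum>j\<in>J. q' j a))"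
  using assms
proof (induction J arbitrary: m m' rule: finite_induct)
  case empty
  have "m a = 0 \<and> m' a = 0" for a
    using empty.prems(4)[of a] cone_nonneg[OF empty.prems(1), of a] cone_nonneg[OF empty.prems(2), of a]
    by simp
  then show ?case by auto
next
  case (insert j J)
  have p: "p j \<in> additive_cone" "(\<lambda>a. \<Sum>i\<in>J. p i a) \<in> additive_cone"
    using insert.prems by (auto intro: cone_sum)
  have "m a + m' a = p j a + (\<Sum>i\<in>J. p i a)" for a
    using insert.prems(4)[of a] insert.hyps by simp
  then obtain q11 q12 q21 q22 where q: "q11 \<in> additive_cone" "q12 \<in> additive_cone" "q21 \<in> additive_cone" "q22 \<in> additive_cone"
    "\<And>a. m a = q11 a + q12 a" "\<And>a. m' a = q21 a + q22 a"
    "\<And>a. p j a = q11 a + q21 a" "\<And>a. (\<Sum>i\<in>J. p i a) = q12 a + q22 a"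
    by (rule cone_refinement_2x2[OF insert.prems(1,2) p]) blast
  have "\<exists>r r'. (\<forall>i\<in>J. r i \<in> additive_cone \<and> r' i \<in> additive_cone \<and> (\<forall>a. p i a = r i a + r' i a)) \<and>
    (\<forall>a. q12 a = (\<Sum>i\<in>J. r i a) \<and> q22 a = (\<Sum>i\<in>J. r' i a))"
    by (rule insert.IH[OF q(2,4)]) (use insert.prems(3) q(8) in auto)
  then obtain r r' where r: "\<And>i. i \<in> J \<Longrightarrow> r i \<in> additive_cone \<and> r' i \<in> additive_cone \<and> (\<forall>a. p i a = r i a + r' i a)"
    "\<And>a. q12 a = (\<Sum>i\<in>J. r i a)" "\<And>a. q22 a = (\<Sum>i\<in>J. r' i a)"
    by blast
  have ne: "i \<noteq> j" if "i \<in> J" for i using that insert.hyps by auto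
  have upd: "(\<Sum>i\<in>insert j J. (r(j := q11)) i a) = m a" "(\<Sum>i\<in>insert j J. (r'(j := q21)) i a) = m' a" for a
    using insert.hyps q(5,6) r(2,3) ne by (simp_all cong: sum.cong)
  show ?case
    by (rule exI[of _ "r(j := q11)"], rule exI[of _ "r'(j := q21)"])
      (use upd q(1,3,7) r(1) ne in auto)
qed

text \<open>The row \<open>i\<close> is separated from the sum of the other rows. The reduced
  columns \<open>q'\<close> that remain are the new columns in the induction hypothesis, which is
  why \<open>p\<close> is generalised.\<close>

lemma cone_refinement:
  assumes "finite I" "finite J" "\<And>i. i \<in> I \<Longrightarrow> m i \<in> additive_cone" "\<And>j. j \<in> J \<Longrightarrow> p j \<in> additive_cone"
    and "\<And>a. (\<Sum>i\<in>I. m i a) = (\<Sum>j\<in>J. p j a)"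
  shows "\<exists>w. (\<forall>i\<in>I. \<forall>j\<in>J. w i j \<in> additive_cone) \<and> (\<forall>i\<in>I. \<forall>a. m i a = (\<Sum>j\<in>J. w i j a)) \<and>
    (\<forall>j\<in>J. \<forall>a. p j a = (\<Sum>i\<in>I. w i j a))"
  using assms(1,3-5)
proof (induction I arbitrary: p rule: finite_induct)
  case empty
  have "p j a = 0" if "j \<in> J" for j a
    using empty.prems(3)[of a] cone_nonneg[OF empty.prems(2)] \<open>finite J\<close> that
    by (simp add: sum_nonneg_eq_0_iff)
  then show ?case by auto
next
  case (insert i I)
  have "(\<lambda>a. \<Sum>i\<in>I. m i a) \<in> additive_cone" using insert.prems by (auto intro: cone_sum)
  moreover have "m i a + (\<Sum>i\<in>I. m i a) = (\<Sum>j\<in>J. p j a)" for a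
    using insert.prems(3)[of a] insert.hyps by simp
  ultimately have "\<exists>q q'. (\<forall>j\<in>J. q j \<in> additive_cone \<and> q' j \<in> additive_cone \<and> (\<forall>a. p j a = q j a + q' j a)) \<and>
    (\<forall>a. m i a = (\<Sum>j\<in>J. q j a) \<and> (\<Sum>i\<in>I. m i a) = (\<Sum>j\<in>J. q' j a))"
    by (intro cone_refinement_2xn[OF \<open>finite J\<close>] insert.prems) auto
  then obtain q q' where q: "\<And>j. j \<in> J \<Longrightarrow> q j \<in> additive_cone \<and> q' j \<in> additive_cone \<and> (\<forall>a. p j a = q j a + q' j a)"
    "\<And>a. m i a = (\<Sum>j\<in>J. q j a)" "\<And>a. (\<Sum>i\<in>I. m i a) = (\<Sum>j\<in>J. q' j a)"
    by blast
  have "\<exists>w. (\<forall>i\<in>I. \<forall>j\<in>J. w i j \<in> additive_cone) \<and> (\<forall>i\<in>I. \<forall>a. m i a = (\<Sum>j\<in>J. w i j a)) \<and>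
    (\<forall>j\<in>J. \<forall>a. q' j a = (\<Sum>i\<in>I. w i j a))"
    by (rule insert.IH) (use insert.prems q in auto)
  then obtain w where w: "\<And>i j. i \<in> I \<Longrightarrow> j \<in> J \<Longrightarrow> w i j \<in> additive_cone"
    "\<And>i a. i \<in> I \<Longrightarrow> m i a = (\<Sum>j\<in>J. w i j a)" "\<And>j a. j \<in> J \<Longrightarrow> q' j a = (\<Sum>i\<in>I. w i j a)"
    by blast
  have ne: "k \<noteq> i" if "k \<in> I" for k using that insert.hyps by auto
  have "p j a = (\<Sum>k\<in>insert i I. (w(i := q)) k j a)" if "j \<in> J" for j a
    using insert.hyps q(1)[OF that] w(3)[OF that] ne by (simp cong: sum.cong)
  then show ?case
    by (intro exI[of _ "w(i := q)"]) (use q w ne in auto)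
qed

section \<open>Convex functions as subadditive functions on the cone\<close>

text \<open>The contribution of a piece \<open>m\<close> to the integral of \<open>f\<close> against
  the discrete measure of a decomposition. If \<open>m u = 0\<close>, the value is 0 whatever
  \<open>f\<close> does at the meaningless quotient.\<close>

definition perspective :: "(('a \<Rightarrow> real) \<Rightarrow> real) \<Rightarrow> ('a \<Rightarrow> real) \<Rightarrow> real" where
  "perspective f m = m u * f (\<lambda>a. m a / m u)"

lemma perspective_state: "s \<in> states pe u \<Longrightarrow> perspective f s = f s"
  by (simp add: perspective_def states_iff)

lemma perspective_add: "perspective (\<lambda>x. f x + g x) m = perspective f m + perspective g m"
  by (simp add: perspective_def distrib_left)

lemma perspective_scale: "perspective (\<lambda>x. c * f x) m = c * perspective f m"
  by (simp add: perspective_def)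

lemma perspective_mono:
  assumes "m \<in> additive_cone" "\<And>x. x \<in> states pe u \<Longrightarrow> f x \<le> g x"
  shows "perspective f m \<le> perspective g m"
proof (cases "m u = 0")
  case False
  then show ?thesis
    using assms normalized_in_states cone_nonneg[of m u]
    by (auto simp: perspective_def intro: mult_left_mono)
qed (simp add: perspective_def)

text \<open>The normalised sum is the convex combination of the normalised summands with weight
  \<open>t = m u / (m u + p u)\<close>; clearing denominators in convexity gives the claim. A
  summand of mass zero is the zero map.\<close>

lemma perspective_subadditive:
  assumes f: "f \<in> Con (states pe u)" and m: "m \<in> additive_cone" and p: "p \<in> additive_cone"
  shows "perspective f (\<lambda>a. m a + p a) \<le> perspective f m + perspective f p"
proof -
  have null: "q = (\<lambda>a. 0)" if "q \<in> additive_cone" "q u = 0" for q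
    using cone_le_unit[OF that(1)] cone_nonneg[OF that(1)] that(2) by (auto intro!: ext antisym)
  show ?thesis
  proof (cases "m u = 0 \<or> p u = 0")
    case True
    then show ?thesis using null[OF m] null[OF p] by (auto simp: perspective_def)
  next
    case False
    then have pos: "0 < m u" "0 < p u"
      using cone_nonneg[OF m, of u] cone_nonneg[OF p, of u] by auto
    define t where "t = m u / (m u + p u)"
    have t: "0 \<le> t" "t \<le> 1" using pos by (auto simp: t_def)
    have t': "1 - t = p u / (m u + p u)" using pos by (simp add: t_def field_simps)
    have c: "cmb t (\<lambda>a. m a / m u) (\<lambda>a. p a / p u) = (\<lambda>a. (m a + p a) / (m u + p u))"
      unfolding cmb_def t' using pos by (simp add: t_def add_divide_distrib)
    have "f (\<lambda>a. (m a + p a) / (m u + p u)) \<le> t * f (\<lambda>a. m a / m u) + (1 - t) * f (\<lambda>a. p a / p u)"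
      unfolding c[symmetric] using pos
      by (intro ConD(2)[OF f _ _ t] normalized_in_states m p) auto
    then have "(m u + p u) * f (\<lambda>a. (m a + p a) / (m u + p u))
        \<le> (m u + p u) * (t * f (\<lambda>a. m a / m u) + (1 - t) * f (\<lambda>a. p a / p u))"
      using pos by (intro mult_left_mono) auto
    also have "\<dots> = ((m u + p u) * t) * f (\<lambda>a. m a / m u) + ((m u + p u) * (1 - t)) * f (\<lambda>a. p a / p u)"
      by (simp add: algebra_simps)
    also have "\<dots> = m u * f (\<lambda>a. m a / m u) + p u * f (\<lambda>a. p a / p u)"
      unfolding t' using pos by (simp add: t_def)
    finally show ?thesis by (simp add: perspective_def)
  qed
qed

lemma perspective_sum_le:
  assumes f: "f \<in> Con (states pe u)" and m: "\<And>i. i \<in> I \<Longrightarrow> m i \<in> additive_cone"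
  shows "perspective f (\<lambda>a. \<Sum>i\<in>I. m i a) \<le> (\<Sum>i\<in>I. perspective f (m i))"
  using m
proof (induction I rule: infinite_finite_induct)
  case (insert i I)
  have "perspective f (\<lambda>a. \<Sum>i\<in>insert i I. m i a) = perspective f (\<lambda>a. m i a + (\<Sum>i\<in>I. m i a))"
    using insert.hyps by simp
  also have "\<dots> \<le> perspective f (m i) + perspective f (\<lambda>a. \<Sum>i\<in>I. m i a)"
    using insert.prems by (intro perspective_subadditive[OF f] cone_sum) auto
  also have "\<dots> \<le> (\<Sum>i\<in>insert i I. perspective f (m i))"
    using insert by simp
  finally show ?case .
qed (simp_all add: perspective_def)

end

text \<open>For a fixed state \<open>s\<close>, \<open>envelope f\<close> is the value at \<open>s\<close> of the upper envelope of \<open>f\<close>: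
  a finite decomposition of \<open>s\<close> in the additive_cone is a discrete measure with barycentre \<open>s\<close>.\<close>

locale state_on_pseudo_effect_algebra_RDP = pseudo_effect_algebra_RDP +
  fixes s
  assumes state: "s \<in> states pe u"
begin

section \<open>The envelope as an additive functional\<close>

definition decomposition_values :: "(('a \<Rightarrow> real) \<Rightarrow> real) \<Rightarrow> real set" where
  "decomposition_values f = {\<Sum>i\<in>I. perspective f (m i) | (I :: nat set) m.
     finite I \<and> (\<forall>i\<in>I. m i \<in> additive_cone) \<and> (\<forall>a. s a = (\<Sum>i\<in>I. m i a))}"

definition envelope :: "(('a \<Rightarrow> real) \<Rightarrow> real) \<Rightarrow> real" where
  "envelope f = Sup (decomposition_values f)"

lemma decomposition_valuesE:
  assumes "v \<in> decomposition_values f"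
  obtains I :: "nat set" and m where "finite I" "\<And>i. i \<in> I \<Longrightarrow> m i \<in> additive_cone"
    "\<And>a. s a = (\<Sum>i\<in>I. m i a)" "v = (\<Sum>i\<in>I. perspective f (m i))"
  using assms unfolding decomposition_values_def by blast

text \<open>Values are collected over index sets of naturals so that a fixed type is quantified.
  Reindexing admits any finite index set, in particular the product \<open>I \<times> J\<close> of a
  refinement.\<close>

lemma decomposition_valuesI:
  assumes I: "finite I" "\<And>i. i \<in> I \<Longrightarrow> m i \<in> additive_cone" "\<And>a. s a = (\<Sum>i\<in>I. m i a)"
  shows "(\<Sum>i\<in>I. perspective f (m i)) \<in> decomposition_values f"
proof -
  obtain h where h: "bij_betw h {0..<card I} I"
    using ex_bij_betw_nat_finite[OF I(1)] by blast
  have *: "(\<Sum>i\<in>I. F i) = (\<Sum>k\<in>{0..<card I}. F (h k))" for F :: "_ \<Rightarrow> real"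
    by (rule sum.reindex_bij_betw[OF h, symmetric])
  show ?thesis
    unfolding decomposition_values_def
  proof (rule CollectI, intro exI conjI)
    show "(\<Sum>i\<in>I. perspective f (m i)) = (\<Sum>k\<in>{0..<card I}. perspective f (m (h k)))" by (rule *)
    show "\<forall>a. s a = (\<Sum>k\<in>{0..<card I}. m (h k) a)" using I(3) * by simp
    show "\<forall>k\<in>{0..<card I}. m (h k) \<in> additive_cone" using I(2) bij_betwE[OF h] by auto
  qed simp
qed

lemma state_value: "f s \<in> decomposition_values f"
  using decomposition_valuesI[of "{()}" "\<lambda>_. s" f] state by (simp add: perspective_state states_iff)

lemma bdd_above_decomposition_values:
  assumes "f \<in> Con (states pe u)"
  shows "bdd_above (decomposition_values f)"
proof -
  obtain B where B: "\<And>x. x \<in> states pe u \<Longrightarrow> \<bar>f x\<bar> \<le> B"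
    using compact_abs_bound[OF compact_states ConD(1)[OF assms]] by metis
  have "v \<le> B" if v: "v \<in> decomposition_values f" for v
  proof -
    from v obtain I :: "nat set" and m where m: "finite I" "\<And>i. i \<in> I \<Longrightarrow> m i \<in> additive_cone"
      "\<And>a. s a = (\<Sum>i\<in>I. m i a)" "v = (\<Sum>i\<in>I. perspective f (m i))"
      by (rule decomposition_valuesE) blast
    have "v \<le> (\<Sum>i\<in>I. perspective (\<lambda>x. B) (m i))"
      unfolding m(4) by (intro sum_mono perspective_mono m abs_le_D1[OF B])
    also have "\<dots> = (\<Sum>i\<in>I. m i u) * B" by (simp add: perspective_def sum_distrib_right)
    also have "\<dots> = B" using m(3)[of u] state by (simp add: states_iff)
    finally show ?thesis .
  qed
  then show ?thesis by (rule bdd_aboveI)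
qed

lemma le_envelope: "f \<in> Con (states pe u) \<Longrightarrow> v \<in> decomposition_values f \<Longrightarrow> v \<le> envelope f"
  unfolding envelope_def by (rule cSup_upper[OF _ bdd_above_decomposition_values])

lemma envelope_le: "(\<And>v. v \<in> decomposition_values f \<Longrightarrow> v \<le> c) \<Longrightarrow> envelope f \<le> c"
  unfolding envelope_def using state_value[of f] by (intro cSup_least) auto

text \<open>Superadditivity is the point. Decompositions chosen for \<open>f\<close> and for
  \<open>g\<close> have a common refinement \<open>q\<close>; passing to it raises both sums, so a
  single decomposition serves \<open>f + g\<close>.\<close>

lemma envelope_add:
  assumes f: "f \<in> Con (states pe u)" and g: "g \<in> Con (states pe u)"
  shows "envelope (\<lambda>x. f x + g x) = envelope f + envelope g"
proof (rule antisym)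
  show "envelope (\<lambda>x. f x + g x) \<le> envelope f + envelope g"
  proof (rule envelope_le)
    fix v assume "v \<in> decomposition_values (\<lambda>x. f x + g x)"
    then obtain I :: "nat set" and m where m: "finite I" "\<And>i. i \<in> I \<Longrightarrow> m i \<in> additive_cone"
      "\<And>a. s a = (\<Sum>i\<in>I. m i a)" "v = (\<Sum>i\<in>I. perspective (\<lambda>x. f x + g x) (m i))"
      by (rule decomposition_valuesE) blast
    then show "v \<le> envelope f + envelope g"
      using le_envelope[OF f decomposition_valuesI[OF m(1-3)]]
        le_envelope[OF g decomposition_valuesI[OF m(1-3)]]
      by (simp add: perspective_add sum.distrib)
  qed
next
  have key: "v + w \<le> envelope (\<lambda>x. f x + g x)"
    if v: "v \<in> decomposition_values f" and w: "w \<in> decomposition_values g" for v w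
  proof -
    from v obtain I :: "nat set" and m where m: "finite I" "\<And>i. i \<in> I \<Longrightarrow> m i \<in> additive_cone"
      "\<And>a. s a = (\<Sum>i\<in>I. m i a)" "v = (\<Sum>i\<in>I. perspective f (m i))"
      by (rule decomposition_valuesE) blast
    from w obtain J :: "nat set" and p where p: "finite J" "\<And>j. j \<in> J \<Longrightarrow> p j \<in> additive_cone"
      "\<And>a. s a = (\<Sum>j\<in>J. p j a)" "w = (\<Sum>j\<in>J. perspective g (p j))"
      by (rule decomposition_valuesE) blast
    have "(\<Sum>i\<in>I. m i a) = (\<Sum>j\<in>J. p j a)" for a using m(3)[of a] p(3)[of a] by simp
    from cone_refinement[OF m(1) p(1) m(2) p(2) this]
    obtain q where q: "\<And>i j. i \<in> I \<Longrightarrow> j \<in> J \<Longrightarrow> q i j \<in> additive_cone"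
      "\<And>i a. i \<in> I \<Longrightarrow> m i a = (\<Sum>j\<in>J. q i j a)" "\<And>j a. j \<in> J \<Longrightarrow> p j a = (\<Sum>i\<in>I. q i j a)"
      by blast
    let ?h = "\<lambda>x. f x + g x"
    have mq: "m i = (\<lambda>a. \<Sum>j\<in>J. q i j a)" if "i \<in> I" for i using q(2)[OF that] by auto
    have pq: "p j = (\<lambda>a. \<Sum>i\<in>I. q i j a)" if "j \<in> J" for j using q(3)[OF that] by auto
    have "v \<le> (\<Sum>i\<in>I. \<Sum>j\<in>J. perspective f (q i j))"
      unfolding m(4) using q(1) by (intro sum_mono) (simp add: mq perspective_sum_le[OF f])
    moreover have "w \<le> (\<Sum>j\<in>J. \<Sum>i\<in>I. perspective g (q i j))"
      unfolding p(4) using q(1) by (intro sum_mono) (simp add: pq perspective_sum_le[OF g])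
    moreover have "(\<Sum>j\<in>J. \<Sum>i\<in>I. perspective g (q i j)) = (\<Sum>i\<in>I. \<Sum>j\<in>J. perspective g (q i j))"
      by (rule sum.swap)
    ultimately have "v + w \<le> (\<Sum>i\<in>I. \<Sum>j\<in>J. perspective ?h (q i j))"
      by (simp add: perspective_add sum.distrib)
    also have "\<dots> = (\<Sum>ij\<in>I \<times> J. perspective ?h (q (fst ij) (snd ij)))"
      by (simp add: sum.cartesian_product case_prod_beta)
    also have "\<dots> \<le> envelope ?h"
    proof (rule le_envelope[OF Con_add[OF f g] decomposition_valuesI])
      show "s a = (\<Sum>ij\<in>I \<times> J. q (fst ij) (snd ij) a)" for a
        using m(3)[of a] q(2) sum.cartesian_product[of "\<lambda>i j. q i j a" J I]
        by (simp add: case_prod_beta)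
    qed (use m(1) p(1) q(1) in auto)
    finally show ?thesis .
  qed
  have "envelope f \<le> envelope (\<lambda>x. f x + g x) - w" if "w \<in> decomposition_values g" for w
    by (rule envelope_le) (use key[OF _ that] in \<open>force simp: le_diff_eq\<close>)
  then have "envelope g \<le> envelope (\<lambda>x. f x + g x) - envelope f"
    by (intro envelope_le) (force simp: le_diff_eq add.commute)
  then show "envelope f + envelope g \<le> envelope (\<lambda>x. f x + g x)" by simp
qed

lemma envelope_const: "envelope (\<lambda>x. c) = c"
proof (rule antisym)
  show "envelope (\<lambda>x. c) \<le> c"
  proof (rule envelope_le)
    fix v assume "v \<in> decomposition_values (\<lambda>x. c)"
    then obtain I :: "nat set" and m where m: "finite I" "\<And>i. i \<in> I \<Longrightarrow> m i \<in> additive_cone"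
      "\<And>a. s a = (\<Sum>i\<in>I. m i a)" "v = (\<Sum>i\<in>I. perspective (\<lambda>x. c) (m i))"
      by (rule decomposition_valuesE) blast
    have "v = s u * c" unfolding m(3,4) by (simp add: perspective_def sum_distrib_right)
    then show "v \<le> c" using state by (simp add: states_iff)
  qed
  show "c \<le> envelope (\<lambda>x. c)" by (rule le_envelope[OF Con_const state_value])
qed

lemma envelope_mono:
  assumes g: "g \<in> Con (states pe u)" and le: "\<And>x. x \<in> states pe u \<Longrightarrow> f x \<le> g x"
  shows "envelope f \<le> envelope g"
proof (rule envelope_le)
  fix v assume "v \<in> decomposition_values f"
  then obtain I :: "nat set" and m where m: "finite I" "\<And>i. i \<in> I \<Longrightarrow> m i \<in> additive_cone"
    "\<And>a. s a = (\<Sum>i\<in>I. m i a)" "v = (\<Sum>i\<in>I. perspective f (m i))"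
    by (rule decomposition_valuesE) blast
  have "v \<le> (\<Sum>i\<in>I. perspective g (m i))"
    unfolding m(4) by (intro sum_mono perspective_mono m le)
  also have "\<dots> \<le> envelope g" by (rule le_envelope[OF g decomposition_valuesI[OF m(1-3)]])
  finally show "v \<le> envelope g" .
qed

lemma envelope_scale_le:
  assumes f: "f \<in> Con (states pe u)" and c: "0 \<le> c"
  shows "envelope (\<lambda>x. c * f x) \<le> c * envelope f"
proof (rule envelope_le)
  fix v assume "v \<in> decomposition_values (\<lambda>x. c * f x)"
  then obtain I :: "nat set" and m where m: "finite I" "\<And>i. i \<in> I \<Longrightarrow> m i \<in> additive_cone"
    "\<And>a. s a = (\<Sum>i\<in>I. m i a)" "v = (\<Sum>i\<in>I. perspective (\<lambda>x. c * f x) (m i))"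
    by (rule decomposition_valuesE) blast
  have "v = c * (\<Sum>i\<in>I. perspective f (m i))"
    by (simp add: m(4) perspective_scale sum_distrib_left)
  also have "\<dots> \<le> c * envelope f"
    by (rule mult_left_mono[OF le_envelope[OF f decomposition_valuesI[OF m(1-3)]] c])
  finally show "v \<le> c * envelope f" .
qed

lemma envelope_scale:
  assumes f: "f \<in> Con (states pe u)" and c: "0 \<le> c"
  shows "envelope (\<lambda>x. c * f x) = c * envelope f"
proof (cases "c = 0")
  case True
  then show ?thesis by (simp add: envelope_const)
next
  case False
  then have "envelope (\<lambda>x. inverse c * (c * f x)) \<le> inverse c * envelope (\<lambda>x. c * f x)"
    using c by (intro envelope_scale_le Con_scale f) auto
  moreover have "(\<lambda>x. inverse c * (c * f x)) = f" using False by auto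
  ultimately have "c * envelope f \<le> c * (inverse c * envelope (\<lambda>x. c * f x))"
    using c by (simp add: mult_left_mono)
  also have "\<dots> = envelope (\<lambda>x. c * f x)" using False by simp
  finally show ?thesis using envelope_scale_le[OF f c] by simp
qed

lemma Con_functional_envelope: "Con_functional (states pe u) envelope"
  by unfold_locales
    (use compact_states state in \<open>auto simp: envelope_add envelope_scale envelope_const envelope_mono\<close>)

section \<open>Comparison of representing measures with the envelope\<close>

text \<open>The box is closed, with non-strict bounds, because a barycentre obtained by averaging
  inherits inequalities only in this form.\<close>

lemma continuous_at_state:
  assumes f: "continuous_on (states pe u) f" and x: "x \<in> states pe u" and e: "0 < (e::real)"
  shows "\<exists>F d. finite F \<and> (\<forall>i\<in>F. 0 < d i) \<and>
    (\<forall>y\<in>states pe u. (\<forall>i\<in>F. \<bar>y i - x i\<bar> \<le> d i) \<longrightarrow> \<bar>f y - f x\<bar> < e)"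
proof -
  have "openin (top_of_set (states pe u)) (states pe u \<inter> f -` ball (f x) e)"
    by (rule continuous_openin_preimage_gen[OF f]) simp
  then obtain T where T: "open T" "states pe u \<inter> f -` ball (f x) e = states pe u \<inter> T"
    unfolding openin_open by blast
  have "x \<in> T" using T(2) x e by auto
  then obtain X where X: "x \<in> (\<Pi>\<^sub>E i\<in>UNIV. X i)" "\<And>i. openin euclideanreal (X i)"
    "finite {i. X i \<noteq> topspace euclideanreal}" "(\<Pi>\<^sub>E i\<in>UNIV. X i) \<subseteq> T"
    using product_topology_open_contains_basis[of "\<lambda>_. euclideanreal" UNIV T x] T(1)
    unfolding open_fun_def by auto
  have "\<exists>d>0. cball (x i) d \<subseteq> X i" for i
    using X(1) X(2)[of i] by (auto simp: open_contains_cball PiE_iff)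
  then obtain d where d: "\<And>i. 0 < d i" "\<And>i. cball (x i) (d i) \<subseteq> X i" by metis
  define F where "F = {i. X i \<noteq> UNIV}"
  have "\<bar>f y - f x\<bar> < e" if y: "y \<in> states pe u" "\<forall>i\<in>F. \<bar>y i - x i\<bar> \<le> d i" for y
  proof -
    have "y i \<in> X i" for i
    proof (cases "i \<in> F")
      case True
      then have "y i \<in> cball (x i) (d i)" using y(2) by (simp add: dist_real_def abs_minus_commute)
      then show ?thesis by (rule subsetD[OF d(2)])
    qed (simp add: F_def)
    then have "y \<in> T" using X(4) by (auto simp: PiE_iff)
    then have "f y \<in> ball (f x) e" using T(2) y(1) by auto
    then show ?thesis by (simp add: dist_real_def abs_minus_commute)
  qed
  then show ?thesis using X(3) d(1) by (intro exI[of _ F] exI[of _ d]) (simp add: F_def)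
qed

end

lemma finite_measurable_partition:
  assumes J: "finite J" "J \<subseteq> space M" "space M \<subseteq> (\<Union>y\<in>J. V y)" and V: "\<And>y. y \<in> J \<Longrightarrow> V y \<in> sets M"
  obtains n :: nat and c A where "\<And>k. k < n \<Longrightarrow> c k \<in> J" "\<And>k. k < n \<Longrightarrow> A k \<subseteq> V (c k)"
    "\<And>k. A k \<in> sets M" "\<And>x. x \<in> space M \<Longrightarrow> (\<Sum>k<n. indicator (A k) x) = (1::real)"
proof -
  define n where "n = card J"
  obtain c where c: "bij_betw c {0..<n} J"
    using ex_bij_betw_nat_finite[OF J(1)] by (auto simp: n_def)
  have cJ: "c k \<in> J" if "k < n" for k using bij_betwE[OF c] that by auto
  \<comment> \<open>\<open>disjointed\<close> acts on infinite sequences, so the finite cover is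
    continued by empty sets.\<close>
  define W where "W k = (if k < n then V (c k) else {})" for k
  have W: "range W \<subseteq> sets M" using V cJ by (auto simp: W_def)
  show thesis
  proof (rule that[of n c "disjointed W"])
    show "disjointed W k \<subseteq> V (c k)" if "k < n" for k
      using disjointed_subset[of W k] that by (simp add: W_def)
    show "disjointed W k \<in> sets M" for k
      using sets.range_disjointed_sets[OF W] by auto
    fix x assume x: "x \<in> space M"
    have "J = c ` {0..<n}" using c by (simp add: bij_betw_def)
    then have "x \<in> (\<Union>k\<in>{0..<n}. W k)" using J(3) x by (auto simp: W_def)
    then have "x \<in> (\<Union>k\<in>{..<n}. disjointed W k)"
      by (simp add: finite_UN_disjointed_eq flip: atLeast0LessThan)
    moreover have "disjoint_family_on (disjointed W) {..<n}"
      using disjoint_family_disjointed[of W] by (rule disjoint_family_on_mono[rotated]) simp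
    ultimately show "(\<Sum>k<n. indicator (disjointed W k) x) = (1::real)"
      by (subst indicator_UN_disjoint[symmetric]) auto
  qed (use cJ in auto)
qed

context state_on_pseudo_effect_algebra_RDP
begin

text \<open>The space is cut into finitely many Borel pieces on which \<open>f\<close> is nearly constant, each lying
  in a box; the barycentres of the pieces lie in the same boxes and decompose the state.\<close>

lemma integral_le_envelope:
  assumes M: "finite_measure M" "sets M = sets (borelK (states pe u))"
    and bary: "\<And>a. (\<integral>x. x a \<partial>M) = s a" and f: "f \<in> Con (states pe u)"
  shows "(\<integral>x. f x \<partial>M) \<le> envelope f"
proof (rule field_le_epsilon)
  fix d :: real assume d: "0 < d"
  interpret finite_measure M by fact
  let ?K = "states pe u"
  have space: "space M = ?K" using sets_eq_imp_space_eq[OF M(2)] by (simp add: space_borelK)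
  have coord: "continuous_on ?K (\<lambda>x. x a)" for a
    using ConD(1)[OF Con_affine_coordinate[of 0 1 a]] by simp
  have cf: "continuous_on ?K f" by (rule ConD(1)[OF f])
  have int: "integrable M g" if "continuous_on ?K g" for g :: "_ \<Rightarrow> real"
    by (rule integrable_continuous_borelK[OF compact_states M that])
  \<comment> \<open>A point of a piece and the barycentre of the piece are each compared with the
    centre of the box.\<close>
  define e where "e = d / 2"
  have e: "0 < e" using d by (simp add: e_def)
  \<comment> \<open>Coordinates and tolerances form one pair, so that a single choice yields
    both.\<close>
  have "\<forall>x\<in>?K. \<exists>Fd. finite (fst Fd) \<and> (\<forall>i\<in>fst Fd. 0 < snd Fd i) \<and>
    (\<forall>y\<in>?K. (\<forall>i\<in>fst Fd. \<bar>y i - x i\<bar> \<le> snd Fd i) \<longrightarrow> \<bar>f y - f x\<bar> < e)"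
    using continuous_at_state[OF cf _ e] by simp
  from bchoice[OF this] obtain Fd where
    Fd: "\<And>x. x \<in> ?K \<Longrightarrow> finite (fst (Fd x))" "\<And>x i. x \<in> ?K \<Longrightarrow> i \<in> fst (Fd x) \<Longrightarrow> 0 < snd (Fd x) i"
      "\<And>x y. x \<in> ?K \<Longrightarrow> y \<in> ?K \<Longrightarrow> (\<forall>i\<in>fst (Fd x). \<bar>y i - x i\<bar> \<le> snd (Fd x) i) \<Longrightarrow> \<bar>f y - f x\<bar> < e"
    by blast
  define V where "V x = ?K \<inter> (\<Inter>i\<in>fst (Fd x). {y. \<bar>y i - x i\<bar> < snd (Fd x) i})" for x
  have V: "openin (top_of_set ?K) (V x)" "x \<in> V x" if "x \<in> ?K" for x
  proof -
    have "open (\<Inter>i\<in>fst (Fd x). {y. \<bar>y i - x i\<bar> < snd (Fd x) i})"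
      by (intro open_INT Fd(1)[OF that] ballI open_Collect_less continuous_intros
          continuous_on_product_coordinates)
    then show "openin (top_of_set ?K) (V x)"
      unfolding V_def openin_open by blast
    show "x \<in> V x" using that Fd(2)[OF that] by (simp add: V_def)
  qed
  obtain J where J: "finite J" "J \<subseteq> ?K" "?K \<subseteq> (\<Union>y\<in>J. V y)"
    using compact_openin_finite_subcover[OF compact_states V] by blast
  have VM: "V y \<in> sets M" if "y \<in> J" for y
    using V(1) J(2) that by (auto simp: M(2) intro: openin_borelK)
  obtain n and c :: "nat \<Rightarrow> 'a \<Rightarrow> real" and A where A: "\<And>k. k < n \<Longrightarrow> c k \<in> J" "\<And>k. k < n \<Longrightarrow> A k \<subseteq> V (c k)"
    "\<And>k. A k \<in> sets M" "\<And>x. x \<in> ?K \<Longrightarrow> (\<Sum>k<n. indicator (A k) x) = (1::real)"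
    by (rule finite_measurable_partition[OF J(1) J(2,3)[folded space] VM]) (auto simp: space)
  have intA: "integrable M (\<lambda>x. indicator (A k) x * g x)" if "continuous_on ?K g" for g :: "_ \<Rightarrow> real" and k
    using integrable_mult_indicator[OF A(3) int[OF that], of k] by simp
  have AK: "A k \<subseteq> ?K" for k using sets.sets_into_space[OF A(3)] by (simp add: space)
  have split: "(\<integral>x. g x \<partial>M) = (\<Sum>k<n. \<integral>x. indicator (A k) x * g x \<partial>M)"
    if g: "continuous_on ?K g" for g :: "_ \<Rightarrow> real"
  proof -
    have "(\<Sum>k<n. \<integral>x. indicator (A k) x * g x \<partial>M) = (\<integral>x. (\<Sum>k<n. indicator (A k) x * g x) \<partial>M)"
      by (rule Bochner_Integration.integral_sum[symmetric]) (rule intA[OF g])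
    also have "\<dots> = (\<integral>x. g x \<partial>M)"
      using A(4) by (intro Bochner_Integration.integral_cong) (auto simp: space simp flip: sum_distrib_right)
    finally show ?thesis by simp
  qed
  \<comment> \<open>The unnormalised barycentre of the piece \<open>A k\<close>; integrating states
    over a piece preserves positivity and additivity.\<close>
  define m where "m k a = (\<integral>x. indicator (A k) x * x a \<partial>M)" for k a
  have m: "m k \<in> additive_cone" for k
    unfolding additive_cone_def
  proof (intro CollectI conjI allI impI)
    show "0 \<le> m k a" for a
      unfolding m_def
      by (rule Bochner_Integration.integral_nonneg_AE, rule AE_I2) (simp add: space states_iff cone_nonneg)
    fix a b c assume "pe a b = Some c"
    then have "m k c = (\<integral>x. indicator (A k) x * x a + indicator (A k) x * x b \<partial>M)"
      unfolding m_def
      by (intro Bochner_Integration.integral_cong) (auto simp: space states_iff cone_additive distrib_left)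
    also have "\<dots> = m k a + m k b"
      unfolding m_def by (rule Bochner_Integration.integral_add) (rule intA[OF coord])+
    finally show "m k c = m k a + m k b" .
  qed
  have mu: "m k u = measure M (A k)" for k
  proof -
    have "m k u = (\<integral>x. indicator (A k) x \<partial>M)"
      unfolding m_def by (intro Bochner_Integration.integral_cong) (auto simp: space states_iff)
    then show ?thesis using A(3)[of k] AK[of k] by (simp add: space Int_absorb2 Int_absorb1)
  qed
  have bound: "(\<integral>x. indicator (A k) x * g x \<partial>M) \<le> r * measure M (A k)"
    if "continuous_on ?K g" "\<And>x. x \<in> A k \<Longrightarrow> g x \<le> r" for g :: "_ \<Rightarrow> real" and r k
  proof -
    have "(\<integral>x. indicator (A k) x * g x \<partial>M) \<le> (\<integral>x. indicator (A k) x * r \<partial>M)"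
      using that by (intro integral_mono intA) (auto simp: indicator_def)
    also have "\<dots> = r * measure M (A k)"
      using A(3)[of k] AK[of k] by (simp add: space Int_absorb2 Int_absorb1)
    finally show ?thesis .
  qed
  have piece: "(\<integral>x. indicator (A k) x * f x \<partial>M) \<le> perspective f (m k) + d * measure M (A k)"
    if k: "k < n" for k
  proof (cases "measure M (A k) = 0")
    \<comment> \<open>A null piece has no barycentre in the state space, but both sides vanish up to
      sign: the integral is at most 0 and the perspective is 0.\<close>
    case True
    obtain B where B: "\<And>x. x \<in> ?K \<Longrightarrow> \<bar>f x\<bar> \<le> B"
      using compact_abs_bound[OF compact_states cf] by metis
    have "(\<integral>x. indicator (A k) x * f x \<partial>M) \<le> B * measure M (A k)"
      by (rule bound[OF cf]) (use AK in \<open>blast intro: abs_le_D1[OF B]\<close>)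
    then show ?thesis using True mu[of k] by (simp add: perspective_def)
  next
    case False
    then have pos: "0 < measure M (A k)" by (simp add: zero_less_measure_iff)
    define y where "y a = m k a / m k u" for a
    have y: "y \<in> ?K"
      unfolding y_def[abs_def] by (rule normalized_in_states[OF m]) (use False mu in simp)
    let ?x = "c k"
    have x: "?x \<in> ?K" using A(1)[OF k] J(2) by auto
    have "\<bar>y i - ?x i\<bar> \<le> snd (Fd ?x) i" if i: "i \<in> fst (Fd ?x)" for i
    proof -
      let ?d = "snd (Fd ?x) i"
      have near: "\<bar>y i - ?x i\<bar> < ?d" if "y \<in> A k" for y
        using A(2)[OF k] that i by (auto simp: V_def)
      have "m k i \<le> (?x i + ?d) * measure M (A k)"
        unfolding m_def by (rule bound[OF coord]) (use near in force)
      \<comment> \<open>\<open>bound\<close> only estimates from above, so the lower estimate of the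
        coordinate is obtained for its negative.\<close>
      moreover have "(\<integral>x. indicator (A k) x * (- x i) \<partial>M) \<le> (?d - ?x i) * measure M (A k)"
        by (rule bound) (use near in \<open>force intro: continuous_on_minus coord\<close>)+
      then have "- m k i \<le> (?d - ?x i) * measure M (A k)"
        unfolding m_def by simp
      ultimately show ?thesis
        unfolding y_def mu using pos by (simp add: abs_le_iff field_simps)
    qed
    then have fy: "\<bar>f y - f ?x\<bar> < e" using Fd(3)[OF x y] by blast
    have "f w \<le> f y + d" if w: "w \<in> A k" for w
    proof -
      have "w \<in> V ?x" using A(2)[OF k] w by auto
      then have "\<bar>f w - f ?x\<bar> < e" by (intro Fd(3)[OF x]) (auto simp: V_def less_imp_le)
      then show ?thesis using fy unfolding e_def by linarith
    qed
    then have "(\<integral>x. indicator (A k) x * f x \<partial>M) \<le> (f y + d) * measure M (A k)"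
      by (rule bound[OF cf])
    then show ?thesis
      by (simp add: perspective_def y_def[abs_def] mu algebra_simps)
  qed
  have "(\<integral>x. f x \<partial>M) \<le> (\<Sum>k<n. perspective f (m k) + d * measure M (A k))"
    unfolding split[OF cf] by (intro sum_mono piece) simp
  also have "\<dots> = (\<Sum>k<n. perspective f (m k)) + d * (\<Sum>k<n. m k u)"
    by (simp add: sum.distrib sum_distrib_left mu)
  also have dec: "(\<Sum>k<n. m k a) = s a" for a
    unfolding m_def using split[OF coord] bary by simp
  then have "(\<Sum>k<n. m k u) = 1" using state by (simp add: states_iff)
  also have "(\<Sum>k<n. perspective f (m k)) \<le> envelope f"
    by (intro le_envelope[OF f] decomposition_valuesI m) (auto simp: dec)
  finally show "(\<integral>x. f x \<partial>M) \<le> envelope f + d" by simp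
qed

end

section \<open>Maximal representing measures\<close>

lemma Aff_Con: "f \<in> Aff K \<Longrightarrow> f \<in> Con K" "f \<in> Aff K \<Longrightarrow> (\<lambda>x. - f x) \<in> Con K"
  by (auto simp: Aff_def Con_def intro: continuous_on_minus)

lemma Aff_coordinate: "(\<lambda>x. x a) \<in> Aff K"
  using ConD(1)[OF Con_affine_coordinate[of 0 1 a K]] by (simp add: Aff_def cmb_def)

lemma integral_return_Aff:
  assumes "s \<in> K" "f \<in> Aff K"
  shows "(\<integral>x. f x \<partial>return (borelK K) s) = f s"
  using assms by (intro integral_return borel_measurable_borelK) (auto simp: space_borelK Aff_def)

text \<open>The order applied to \<open>f\<close> and \<open>- f\<close> pins the integral of an
  affine \<open>f\<close>. Hence anything above a measure representing \<open>s\<close> still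
  represents \<open>s\<close>.\<close>

lemma choquet_le_imp_aff_equiv:
  assumes "choquet_le K M N"
  shows "aff_equiv K M N"
  unfolding aff_equiv_def
proof
  fix f assume f: "f \<in> Aff K"
  have "(\<integral>x. f x \<partial>M) \<le> (\<integral>x. f x \<partial>N)" "(\<integral>x. - f x \<partial>M) \<le> (\<integral>x. - f x \<partial>N)"
    using assms Aff_Con[OF f] by (auto simp: choquet_le_def)
  then show "(\<integral>x. f x \<partial>M) = (\<integral>x. f x \<partial>N)" by simp
qed

context state_on_pseudo_effect_algebra_RDP
begin

text \<open>The envelopes of \<open>f\<close> and \<open>- f\<close> are at least \<open>f s\<close>
  and \<open>- f s\<close>, and by additivity they sum to 0, so neither inequality can be
  strict.\<close>

lemma envelope_Aff:
  assumes f: "f \<in> Aff (states pe u)"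
  shows "envelope f = f s"
proof -
  have "f s \<le> envelope f" "- f s \<le> envelope (\<lambda>x. - f x)"
    using le_envelope[OF Aff_Con(1)[OF f] state_value] le_envelope[OF Aff_Con(2)[OF f] state_value]
    by simp_all
  moreover have "envelope f + envelope (\<lambda>x. - f x) = 0"
    using envelope_add[OF Aff_Con[OF f]] envelope_const[of 0] by simp
  ultimately show ?thesis by simp
qed

lemma aff_equiv_return_iff:
  "aff_equiv (states pe u) M (return (borelK (states pe u)) s)
    \<longleftrightarrow> (\<forall>f\<in>Aff (states pe u). (\<integral>x. f x \<partial>M) = f s)"
  by (simp add: aff_equiv_def integral_return_Aff[OF state])

lemma representing_le_envelope:
  assumes M: "regular_borel_measure (states pe u) M"
    and eq: "aff_equiv (states pe u) M (return (borelK (states pe u)) s)"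
    and f: "f \<in> Con (states pe u)"
  shows "(\<integral>x. f x \<partial>M) \<le> envelope f"
proof (rule integral_le_envelope[OF _ _ _ f])
  show "finite_measure M" "sets M = sets (borelK (states pe u))"
    using M by (simp_all add: regular_borel_measure_def)
  show "(\<integral>x. x a \<partial>M) = s a" for a
    using bspec[OF eq[unfolded aff_equiv_return_iff] Aff_coordinate[of a]] .
qed

theorem greatest_representing_measure:
  obtains \<mu> where "prob_space \<mu>" "regular_borel_measure (states pe u) \<mu>"
    "aff_equiv (states pe u) \<mu> (return (borelK (states pe u)) s)"
    "\<And>M. regular_borel_measure (states pe u) M \<Longrightarrow>
      aff_equiv (states pe u) M (return (borelK (states pe u)) s) \<Longrightarrow> choquet_le (states pe u) M \<mu>"
proof -
  interpret Con_functional "states pe u" envelope by (rule Con_functional_envelope)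
  obtain \<mu> where \<mu>: "regular_borel_measure (states pe u) \<mu>"
      "\<And>f. f \<in> Con (states pe u) \<Longrightarrow> (\<integral>x. f x \<partial>\<mu>) = envelope f"
    by (rule representing_measure_exists) blast
  show thesis
  proof (rule that[OF _ \<mu>(1)])
    have fin: "finite_measure \<mu>" using \<mu>(1) by (simp add: regular_borel_measure_def)
    have "measure \<mu> (space \<mu>) = 1"
      using \<mu>(2)[OF Con_const[of 1]] by (simp add: envelope_const)
    then show "prob_space \<mu>"
      by (intro prob_spaceI) (simp add: finite_measure.emeasure_eq_measure[OF fin])
    show "aff_equiv (states pe u) \<mu> (return (borelK (states pe u)) s)"
      by (simp add: aff_equiv_return_iff \<mu>(2) Aff_Con(1) envelope_Aff)
    show "choquet_le (states pe u) M \<mu>" if "regular_borel_measure (states pe u) M"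
      "aff_equiv (states pe u) M (return (borelK (states pe u)) s)" for M
      unfolding choquet_le_def using representing_le_envelope[OF that] \<mu>(2) by simp
  qed
qed

end

theorem theorem5p5:
  fixes pe :: "'a \<Rightarrow> 'a \<Rightarrow> 'a option" and z u :: 'a and s :: "'a \<Rightarrow> real"
  assumes "pseudo_effect_algebra pe z u"
    and "RDP pe"
    and "states pe u \<noteq> {}"
    and "s \<in> states pe u"
  shows "(\<exists>!\<mu>. prob_space \<mu> \<and> regular_borel_measure (states pe u) \<mu> \<and>
              choquet_maximal (states pe u) \<mu> \<and>
              aff_equiv (states pe u) \<mu> (return (borelK (states pe u)) s)) \<and>
         (\<forall>\<mu>. prob_space \<mu> \<and> regular_borel_measure (states pe u) \<mu> \<and>
              choquet_maximal (states pe u) \<mu> \<and>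
              aff_equiv (states pe u) \<mu> (return (borelK (states pe u)) s) \<longrightarrow>
            (\<forall>a. s a = (\<integral>x. x a \<partial>\<mu>)))"
proof -
  interpret state_on_pseudo_effect_algebra_RDP pe z u s
    by unfold_locales (use assms in auto)
  let ?K = "states pe u"
  obtain \<mu> where \<mu>: "prob_space \<mu>" "regular_borel_measure ?K \<mu>"
    "aff_equiv ?K \<mu> (return (borelK ?K) s)"
    "\<And>M. regular_borel_measure ?K M \<Longrightarrow> aff_equiv ?K M (return (borelK ?K) s) \<Longrightarrow> choquet_le ?K M \<mu>"
    by (rule greatest_representing_measure) blast
  \<comment> \<open>A measure above the greatest one still represents \<open>s\<close>, so it is
    also below it, and antisymmetry applies.\<close>
  have max: "choquet_maximal ?K \<mu>"
    unfolding choquet_maximal_def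
  proof (intro conjI allI impI \<mu>(2))
    fix N assume N: "regular_borel_measure ?K N \<and> choquet_le ?K \<mu> N"
    then have "aff_equiv ?K N (return (borelK ?K) s)"
      using choquet_le_imp_aff_equiv[of ?K \<mu> N] \<mu>(3) by (simp add: aff_equiv_def)
    then have "choquet_le ?K N \<mu>" using N \<mu>(4) by blast
    then show "N = \<mu>"
      using N \<mu>(2) assms(3)
      by (intro regular_measure_eqI_Con[OF compact_states]) (auto simp: choquet_le_def intro: antisym)
  qed
  \<comment> \<open>A maximal representing measure lies below the greatest one, and its maximality
    makes them equal.\<close>
  have uniq: "\<nu> = \<mu>" if "regular_borel_measure ?K \<nu>" "choquet_maximal ?K \<nu>"
    "aff_equiv ?K \<nu> (return (borelK ?K) s)" for \<nu>
    using that \<mu>(2) \<mu>(4)[OF that(1,3)] unfolding choquet_maximal_def by blast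
  have "\<exists>!\<mu>. prob_space \<mu> \<and> regular_borel_measure ?K \<mu> \<and> choquet_maximal ?K \<mu> \<and>
      aff_equiv ?K \<mu> (return (borelK ?K) s)"
    by (rule ex1I[of _ \<mu>]) (use \<mu>(1-3) max uniq in blast)+
  moreover have "s a = (\<integral>x. x a \<partial>\<nu>)" if "aff_equiv ?K \<nu> (return (borelK ?K) s)" for \<nu> a
    using bspec[OF that[unfolded aff_equiv_return_iff] Aff_coordinate[of a]] by simp
  ultimately show ?thesis by blast
qed

end
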